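(* Let $G$ be an effective ample Hausdorff groupoid, let $R$ be a unital commutative ring, and let $(\Sigma,i,q)$ be a discrete twist (by $R^\times$) over $G$. Suppose that $Q$ is a ring and $\pi: A_{R}(G;\Sigma) \to Q$ is a ring homomorphism. Then $\pi$ is injective if and only if $\pi(r\tilde{1}_W) \neq 0$ for every nonempty compact open subset $W$ of $\Sigma^{(0)}$ and every $r \in R \setminus \{0\}$.
   Context: A topological groupoid $G$ (range $r(\alpha)=\alpha\alpha^{-1}$, source $s(\alpha)=\alpha^{-1}\alpha$, unit space $G^{(0)}=r(G)=s(G)$) is étale if $s$ (equivalently $r$) is a local homeomorphism. An open subset $U\subseteq G$ is an open bisection if $r|_U$ and $s|_U$ are homeomorphisms onto open subsets of $G^{(0)}$. An étale groupoid is ample if it has a basis of compact open bisections. $\mathrm{Iso}(G)=\{\gamma\in G: r(\gamma)=s(\gamma)\}$, $\mathrm{Iso}(G)^\circ$ is its topological interior in $G$, and $G$ is effective if $\mathrm{Iso}(G)^\circ=G^{(0)}$. Discrete twist: let $R^\times$ be the group of units of $R$ with the discrete topology. A discrete twist $(\Sigma,i,q)$ by $R^\times$ over an ample Hausdorff groupoid $G$ is a sequence $G^{(0)}\times R^\times \xrightarrow{i}\Sigma\xrightarrow{q} G$, where $G^{(0)}\times R^\times$ is the trivial group bundle with fibres $R^\times$, $\Sigma$ is a Hausdorff étale groupoid with $\Sigma^{(0)}=i(G^{(0)}\times\{1\})$, and $i,q$ are continuous groupoid homomorphisms restricting to homeomorphisms of unit spaces, such that: (DT1) $i(\{x\}\times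 R^\times)=q^{-1}(x)$ for every $x\in G^{(0)}$, $i$ is injective, $q$ is surjective; (DT2) for each $\alpha\in G$ there are an open bisection $B_\alpha\ni\alpha$ of $G$ and a continuous map $P_\alpha:B_\alpha\to\Sigma$ with $q\circ P_\alpha=\mathrm{id}_{B_\alpha}$ such that $(\beta,t)\mapsto i(r(\beta),t)P_\alpha(\beta)$ is a homeomorphism from $B_\alpha\times R^\times$ onto $q^{-1}(B_\alpha)$; (DT3) $i(r(\sigma),t)\sigma=\sigma\, i(s(\sigma),t)$ for all $\sigma\in\Sigma$, $t\in R^\times$ (identifying $\Sigma^{(0)}$ with $G^{(0)}$ via $q$). $R^\times$ acts on $\Sigma$ by $t\cdot\sigma=i(r(\sigma),t)\sigma$. Twisted Steinberg algebra: $A_R(G;\Sigma)$ is the $R$-module of locally constant functions $f:\Sigma\to R$ that are $R^\times$-contravariant, i.e. $f(t\cdot\sigma)=t^{-1}f(\sigma)$, and for which $\mathrm{supp}_G(f):=q(\mathrm{supp}(f))$ is compact, where $\mathrm{supp}(f)=\{\sigma: f(\sigma)\neq0\}$. Its product is $(f*g)(\sigma)=\sum_{\alpha} f(S(\alpha))\,g(S(\alpha)^{-1}\sigma)$, the sum over $\alpha\in \mathrm{supp}_G(f)$ with $r(\alpha)=r(q(\sigma))$, where $S:G\to\Sigma$ is any (not necessarily continuous) section of $q$; the product is independent of $S$. For a compact open bisection $X\subseteq\Sigma$, $\tilde 1_X\in A_R(G;\Sigma)$ is the function with $\tilde 1_X(\sigma)=t^{-1}$ if $\sigma\in t\cdot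 X$ for some $t\in R^\times$, and $\tilde 1_X(\sigma)=0$ otherwise. Ring homomorphisms need not be unital. *)

theory Defs
  imports "HOL-Analysis.Analysis"
begin

section \<open>Topological groupoids\<close>

text \<open>The set of arrows is the underlying set of the topology; the values of the
  operations at other elements of the type (and of the product at non-composable pairs)
  are irrelevant.\<close>

record 'a tgroupoid =
  gtop :: "'a topology"
  gmult :: "'a \<Rightarrow> 'a \<Rightarrow> 'a"  (infixl \<open>\<cdot>\<index>\<close> 70)
  ginv :: "'a \<Rightarrow> 'a"

definition arrows :: "('a, 'm) tgroupoid_scheme \<Rightarrow> 'a set" where
  "arrows G = topspace (gtop G)"

definition rng :: "('a, 'm) tgroupoid_scheme \<Rightarrow> 'a \<Rightarrow> 'a" where
  "rng G a = gmult G a (ginv G a)"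

definition src :: "('a, 'm) tgroupoid_scheme \<Rightarrow> 'a \<Rightarrow> 'a" where
  "src G a = gmult G (ginv G a) a"

definition unit_space :: "('a, 'm) tgroupoid_scheme \<Rightarrow> 'a set" where
  "unit_space G = rng G ` arrows G"

definition unit_top :: "('a, 'm) tgroupoid_scheme \<Rightarrow> 'a topology" where
  "unit_top G = subtopology (gtop G) (unit_space G)"

definition composable :: "('a, 'm) tgroupoid_scheme \<Rightarrow> ('a \<times> 'a) set" where
  "composable G = {(a, b). a \<in> arrows G \<and> b \<in> arrows G \<and> src G a = rng G b}"

locale groupoid =
  fixes G :: "('a, 'm) tgroupoid_scheme" (structure)
  assumes inv_closed: "a \<in> arrows G \<Longrightarrow> ginv G a \<in> arrows G"
    and inv_inv: "a \<in> arrows G \<Longrightarrow> ginv G (ginv G a) = a"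
    and mult_closed: "(a, b) \<in> composable G \<Longrightarrow> a \<cdot> b \<in> arrows G"
    and composable_left: "\<lbrakk>(a, b) \<in> composable G; (b, c) \<in> composable G\<rbrakk> \<Longrightarrow> (a \<cdot> b, c) \<in> composable G"
    and composable_right: "\<lbrakk>(a, b) \<in> composable G; (b, c) \<in> composable G\<rbrakk> \<Longrightarrow> (a, b \<cdot> c) \<in> composable G"
    and assoc: "\<lbrakk>(a, b) \<in> composable G; (b, c) \<in> composable G\<rbrakk> \<Longrightarrow> (a \<cdot> b) \<cdot> c = a \<cdot> (b \<cdot> c)"
    and inv_cancel_left: "(a, b) \<in> composable G \<Longrightarrow> ginv G a \<cdot> (a \<cdot> b) = b"
    and inv_cancel_right: "(a, b) \<in> composable G \<Longrightarrow> (a \<cdot> b) \<cdot> ginv G b = a"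

locale topological_groupoid = groupoid G for G :: "('a, 'm) tgroupoid_scheme" (structure) +
  assumes continuous_mult:
      "continuous_map (subtopology (prod_topology (gtop G) (gtop G)) (composable G)) (gtop G)
         (\<lambda>(a, b). a \<cdot> b)"
    and continuous_inv: "continuous_map (gtop G) (gtop G) (ginv G)"

definition local_homeomorphism_map :: "'a topology \<Rightarrow> 'b topology \<Rightarrow> ('a \<Rightarrow> 'b) \<Rightarrow> bool" where
  "local_homeomorphism_map X Y f \<longleftrightarrow>
     (\<forall>x\<in>topspace X. \<exists>U. openin X U \<and> x \<in> U \<and> openin Y (f ` U) \<and>
        homeomorphic_map (subtopology X U) (subtopology Y (f ` U)) f)"

locale etale_groupoid = topological_groupoid +
  assumes src_local_homeomorphism: "local_homeomorphism_map (gtop G) (unit_top G) (src G)"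

definition open_bisection :: "('a, 'm) tgroupoid_scheme \<Rightarrow> 'a set \<Rightarrow> bool" where
  "open_bisection G U \<longleftrightarrow> openin (gtop G) U \<and>
     (\<forall>f\<in>{rng G, src G}. openin (unit_top G) (f ` U) \<and>
        homeomorphic_map (subtopology (gtop G) U) (subtopology (unit_top G) (f ` U)) f)"

locale ample_groupoid = etale_groupoid +
  assumes compact_open_bisection_basis:
    "\<lbrakk>openin (gtop G) V; a \<in> V\<rbrakk> \<Longrightarrow>
       \<exists>B. compactin (gtop G) B \<and> open_bisection G B \<and> a \<in> B \<and> B \<subseteq> V"

definition iso :: "('a, 'm) tgroupoid_scheme \<Rightarrow> 'a set" where
  "iso G = {a \<in> arrows G. rng G a = src G a}"

definition effective :: "('a, 'm) tgroupoid_scheme \<Rightarrow> bool" where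
  "effective G \<longleftrightarrow> gtop G interior_of iso G = unit_space G"

definition groupoid_hom ::
  "('a, 'm) tgroupoid_scheme \<Rightarrow> ('b, 'n) tgroupoid_scheme \<Rightarrow> ('a \<Rightarrow> 'b) \<Rightarrow> bool" where
  "groupoid_hom G H f \<longleftrightarrow> f ` arrows G \<subseteq> arrows H \<and>
     (\<forall>(a, b)\<in>composable G. (f a, f b) \<in> composable H \<and> f (gmult G a b) = gmult H (f a) (f b))"


section \<open>Discrete twists\<close>

text \<open>The sort \<open>{comm_ring, comm_monoid_mult}\<close> describes unital commutative rings
  without excluding the zero ring, which \<open>comm_ring_1\<close> does.\<close>

definition ring_units :: "'r::{comm_ring, comm_monoid_mult} set" where
  "ring_units = {t. t dvd 1}"

definition unit_inv :: "'r::{comm_ring, comm_monoid_mult} \<Rightarrow> 'r" where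
  "unit_inv t = (THE u. t * u = 1)"

definition trivial_bundle ::
  "('g, 'm) tgroupoid_scheme \<Rightarrow> ('g \<times> 'r::{comm_ring, comm_monoid_mult}) tgroupoid" where
  "trivial_bundle G =
     \<lparr>gtop = prod_topology (unit_top G) (discrete_topology ring_units),
      gmult = (\<lambda>(x, t) (y, u). (x, t * u)),
      ginv = (\<lambda>(x, t). (x, unit_inv t))\<rparr>"

text \<open>The spaces of units of \<open>\<Sigma>\<close> and \<open>G\<close> are identified via \<open>q\<close>, so the expression
  \<open>i (r \<sigma>, t)\<close> of the literature, for \<open>\<sigma>\<close> in \<open>\<Sigma>\<close>, reads \<open>i (q (rng \<Sigma> \<sigma>), t)\<close>.\<close>

locale discrete_twist = G: ample_groupoid G + S: etale_groupoid \<Sigma>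
  for G :: "('g, 'm) tgroupoid_scheme" and \<Sigma> :: "('s, 'n) tgroupoid_scheme" +
  fixes i :: "'g \<times> 'r::{comm_ring, comm_monoid_mult} \<Rightarrow> 's" and q :: "'s \<Rightarrow> 'g"
  assumes Hausdorff_base: "Hausdorff_space (gtop G)"
    and Hausdorff_twist: "Hausdorff_space (gtop \<Sigma>)"
    and unit_space_twist: "unit_space \<Sigma> = i ` (unit_space G \<times> {1})"
    and i_continuous: "continuous_map (gtop (trivial_bundle G)) (gtop \<Sigma>) i"
    and i_hom: "groupoid_hom (trivial_bundle G) \<Sigma> i"
    and i_units: "homeomorphic_map (unit_top (trivial_bundle G)) (unit_top \<Sigma>) i"
    and q_continuous: "continuous_map (gtop \<Sigma>) (gtop G) q"
    and q_hom: "groupoid_hom \<Sigma> G q"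
    and q_units: "homeomorphic_map (unit_top \<Sigma>) (unit_top G) q"
    and fibre_over_unit:
      "x \<in> unit_space G \<Longrightarrow> i ` ({x} \<times> ring_units) = {\<sigma> \<in> arrows \<Sigma>. q \<sigma> = x}"
    and i_inj: "inj_on i (unit_space G \<times> ring_units)"
    and q_surj: "q ` arrows \<Sigma> = arrows G"
    and local_trivialization:
      "\<alpha> \<in> arrows G \<Longrightarrow>
         \<exists>B P. open_bisection G B \<and> \<alpha> \<in> B \<and>
           continuous_map (subtopology (gtop G) B) (gtop \<Sigma>) P \<and> (\<forall>\<beta>\<in>B. q (P \<beta>) = \<beta>) \<and>
           homeomorphic_map
             (prod_topology (subtopology (gtop G) B) (discrete_topology ring_units))
             (subtopology (gtop \<Sigma>) {\<sigma> \<in> arrows \<Sigma>. q \<sigma> \<in> B})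
             (\<lambda>(\<beta>, t). gmult \<Sigma> (i (rng G \<beta>, t)) (P \<beta>))"
    and central:
      "\<lbrakk>\<sigma> \<in> arrows \<Sigma>; t \<in> ring_units\<rbrakk> \<Longrightarrow>
         gmult \<Sigma> (i (q (rng \<Sigma> \<sigma>), t)) \<sigma> = gmult \<Sigma> \<sigma> (i (q (src \<Sigma> \<sigma>), t))"

definition twist_act ::
  "('s, 'n) tgroupoid_scheme \<Rightarrow> ('g \<times> 'r::{comm_ring, comm_monoid_mult} \<Rightarrow> 's) \<Rightarrow> ('s \<Rightarrow> 'g) \<Rightarrow>
   'r \<Rightarrow> 's \<Rightarrow> 's" where
  "twist_act \<Sigma> i q t \<sigma> = gmult \<Sigma> (i (q (rng \<Sigma> \<sigma>), t)) \<sigma>"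


section \<open>Twisted Steinberg algebras\<close>

definition locally_constant_on :: "'a topology \<Rightarrow> ('a \<Rightarrow> 'b) \<Rightarrow> bool" where
  "locally_constant_on X f \<longleftrightarrow>
     (\<forall>x\<in>topspace X. \<exists>U. openin X U \<and> x \<in> U \<and> (\<forall>y\<in>U. f y = f x))"

definition supp :: "('s, 'n) tgroupoid_scheme \<Rightarrow> ('s \<Rightarrow> 'r::zero) \<Rightarrow> 's set" where
  "supp \<Sigma> f = {\<sigma> \<in> arrows \<Sigma>. f \<sigma> \<noteq> 0}"

text \<open>A function on the arrows of \<open>\<Sigma>\<close> is represented by its extension by zero to the
  whole type, so that equality and the linear operations are the pointwise ones.\<close>

definition twisted_steinberg_algebra ::
  "('g, 'm) tgroupoid_scheme \<Rightarrow> ('s, 'n) tgroupoid_scheme \<Rightarrow>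
   ('g \<times> 'r::{comm_ring, comm_monoid_mult} \<Rightarrow> 's) \<Rightarrow> ('s \<Rightarrow> 'g) \<Rightarrow> ('s \<Rightarrow> 'r) set" where
  "twisted_steinberg_algebra G \<Sigma> i q =
     {f. (\<forall>\<sigma>. \<sigma> \<notin> arrows \<Sigma> \<longrightarrow> f \<sigma> = 0) \<and>
         locally_constant_on (gtop \<Sigma>) f \<and>
         (\<forall>\<sigma>\<in>arrows \<Sigma>. \<forall>t\<in>ring_units. f (twist_act \<Sigma> i q t \<sigma>) = unit_inv t * f \<sigma>) \<and>
         compactin (gtop G) (q ` supp \<Sigma> f)}"

text \<open>The product does not depend on the section of \<open>q\<close> (which exists as \<open>q\<close> is
  surjective); the one used here is \<open>inv_into (arrows \<Sigma>) q\<close>. For \<open>f\<close> in the algebra the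
  index set of the sum is finite, being the intersection of a compact set with a fibre of
  the range map of an etale Hausdorff groupoid.\<close>

definition twisted_conv ::
  "('g, 'm) tgroupoid_scheme \<Rightarrow> ('s, 'n) tgroupoid_scheme \<Rightarrow> ('s \<Rightarrow> 'g) \<Rightarrow>
   ('s \<Rightarrow> 'r::{comm_ring, comm_monoid_mult}) \<Rightarrow> ('s \<Rightarrow> 'r) \<Rightarrow> 's \<Rightarrow> 'r" where
  "twisted_conv G \<Sigma> q f g \<sigma> =
     (if \<sigma> \<in> arrows \<Sigma> then
        (let S = inv_into (arrows \<Sigma>) q in
           \<Sum>\<alpha> | \<alpha> \<in> q ` supp \<Sigma> f \<and> rng G \<alpha> = rng G (q \<sigma>).
             f (S \<alpha>) * g (gmult \<Sigma> (ginv \<Sigma> (S \<alpha>)) \<sigma>))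
      else 0)"

text \<open>For a bisection \<open>X\<close> of \<open>\<Sigma>\<close> the scalar \<open>t\<close> below is unique if it exists.\<close>

definition twisted_indicator ::
  "('s, 'n) tgroupoid_scheme \<Rightarrow> ('g \<times> 'r::{comm_ring, comm_monoid_mult} \<Rightarrow> 's) \<Rightarrow> ('s \<Rightarrow> 'g) \<Rightarrow>
   's set \<Rightarrow> 's \<Rightarrow> 'r" where
  "twisted_indicator \<Sigma> i q X \<sigma> =
     (if \<exists>t\<in>ring_units. \<sigma> \<in> twist_act \<Sigma> i q t ` X
      then unit_inv (THE t. t \<in> ring_units \<and> \<sigma> \<in> twist_act \<Sigma> i q t ` X)
      else 0)"

text \<open>Ring homomorphisms from the algebra are not required to preserve units; the class
  \<open>ring\<close> of the codomain does not require one.\<close>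

definition twisted_ring_hom ::
  "('g, 'm) tgroupoid_scheme \<Rightarrow> ('s, 'n) tgroupoid_scheme \<Rightarrow>
   ('g \<times> 'r::{comm_ring, comm_monoid_mult} \<Rightarrow> 's) \<Rightarrow> ('s \<Rightarrow> 'g) \<Rightarrow> (('s \<Rightarrow> 'r) \<Rightarrow> 'q::ring) \<Rightarrow> bool"
  where
  "twisted_ring_hom G \<Sigma> i q \<pi> \<longleftrightarrow>
     (\<forall>f\<in>twisted_steinberg_algebra G \<Sigma> i q. \<forall>g\<in>twisted_steinberg_algebra G \<Sigma> i q.
        \<pi> (\<lambda>\<sigma>. f \<sigma> + g \<sigma>) = \<pi> f + \<pi> g \<and>
        \<pi> (twisted_conv G \<Sigma> q f g) = \<pi> f * \<pi> g)"

end

theory Submission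
  imports Defs
begin

text \<open>An injective homomorphism kills no \<open>r 1\<^sub>W\<close> with \<open>r \<noteq> 0\<close> and \<open>W\<close> nonempty, as this is a nonzero element of
  the algebra. The content is the converse: an element \<open>f \<noteq> 0\<close> of the kernel can be cut down, by
  multiplications, to some \<open>r 1\<^sub>W\<close> with \<open>r \<noteq> 0\<close>, which then lies in the kernel too.

  Say \<open>f \<sigma> = r \<noteq> 0\<close>, and let \<open>Y\<close> be a compact open bisection containing the inverse of \<open>\<sigma>\<close>. Left
  convolution with \<open>1\<^sub>Y\<close> is translation along \<open>Y\<close> (\<open>conv_indicator_left\<close>), so \<open>h = 1\<^sub>Y * f\<close> takes the value \<open>r\<close> at
  the unit \<open>src \<sigma>\<close>, hence at all units near it. Convolving \<open>h\<close> with \<open>1\<^sub>W\<close> on both sides, for \<open>W\<close> a set of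
  units, restricts \<open>h\<close> to the arrows that start and end in \<open>W\<close>. If \<open>W\<close> can be chosen within the set of
  units where \<open>h\<close> is \<open>r\<close> and such that every arrow of \<open>W\<close> to \<open>W\<close> in the support of \<open>h\<close> lies over a unit
  of \<open>G\<close>, then contravariance forces the result to be \<open>r 1\<^sub>W\<close> (\<open>compress_to_indicator\<close>).

  Such a \<open>W\<close> exists because \<open>G\<close> is effective. The arrows of \<open>G\<close> in the support of \<open>h\<close> that are not units form
  a compact set, because the units are open. It is covered by finitely many open bisections without
  units. No nonempty open part of such a bisection consists of isotropy, so each of them contains an
  arrow with two distinct ends nearby, and these ends can be separated; this shrinks a given open set
  of units to a nonempty one that no arrow of the bisection joins to itself
  (\<open>effective_avoid_bisection\<close>, \<open>effective_avoid_compact\<close>).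

  Multiplicativity of the homomorphism is available only inside the algebra, so the intermediate
  products have to be shown to lie in it (\<open>conv_indicator_left_in_steinberg\<close>).\<close>


section \<open>Groupoids\<close>

context groupoid
begin

lemma composable_iff: "(a, b) \<in> composable G \<longleftrightarrow> a \<in> arrows G \<and> b \<in> arrows G \<and> src G a = rng G b"
  by (auto simp: composable_def)

lemma rng_inv [simp]: "a \<in> arrows G \<Longrightarrow> rng G (ginv G a) = src G a"
  by (simp add: rng_def src_def inv_inv)

lemma src_inv [simp]: "a \<in> arrows G \<Longrightarrow> src G (ginv G a) = rng G a"
  by (simp add: rng_def src_def inv_inv)

lemma mult_in_arrows [simp]:
  "\<lbrakk>a \<in> arrows G; b \<in> arrows G; src G a = rng G b\<rbrakk> \<Longrightarrow> a \<cdot> b \<in> arrows G"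
  by (simp add: mult_closed composable_iff)

lemma rng_in_arrows [simp]: "a \<in> arrows G \<Longrightarrow> rng G a \<in> arrows G"
  unfolding rng_def[of G a] by (simp add: inv_closed)

lemma src_in_arrows [simp]: "a \<in> arrows G \<Longrightarrow> src G a \<in> arrows G"
  unfolding src_def[of G a] by (simp add: inv_closed)

lemma rng_mult [simp]:
  assumes "a \<in> arrows G" "b \<in> arrows G" "src G a = rng G b"
  shows "rng G (a \<cdot> b) = rng G a"
  using composable_right[of "ginv G a" a b] assms by (simp add: composable_iff inv_closed)

lemma src_mult [simp]:
  assumes "a \<in> arrows G" "b \<in> arrows G" "src G a = rng G b"
  shows "src G (a \<cdot> b) = src G b"
  using composable_left[of a b "ginv G b"] assms by (simp add: composable_iff inv_closed)

lemma mult_assoc: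
  "\<lbrakk>a \<in> arrows G; b \<in> arrows G; c \<in> arrows G; src G a = rng G b; src G b = rng G c\<rbrakk>
    \<Longrightarrow> (a \<cdot> b) \<cdot> c = a \<cdot> (b \<cdot> c)"
  by (simp add: assoc composable_iff)

lemma inv_mult_cancel:
  "\<lbrakk>a \<in> arrows G; b \<in> arrows G; src G a = rng G b\<rbrakk> \<Longrightarrow> ginv G a \<cdot> (a \<cdot> b) = b"
  by (simp add: inv_cancel_left composable_iff)

lemma mult_inv_cancel:
  "\<lbrakk>a \<in> arrows G; b \<in> arrows G; rng G a = rng G b\<rbrakk> \<Longrightarrow> a \<cdot> (ginv G a \<cdot> b) = b"
  using inv_cancel_left[of "ginv G a" b] by (simp add: composable_iff inv_closed inv_inv)

lemma rng_rng [simp]: "a \<in> arrows G \<Longrightarrow> rng G (rng G a) = rng G a"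
  using rng_mult[of a "ginv G a"] by (simp add: rng_def[of G a, symmetric] inv_closed)

lemma src_rng [simp]: "a \<in> arrows G \<Longrightarrow> src G (rng G a) = rng G a"
  using src_mult[of a "ginv G a"] by (simp add: rng_def[of G a, symmetric] inv_closed)

lemma rng_src [simp]: "a \<in> arrows G \<Longrightarrow> rng G (src G a) = src G a"
  using rng_rng[of "ginv G a"] by (simp add: inv_closed)

lemma src_src [simp]: "a \<in> arrows G \<Longrightarrow> src G (src G a) = src G a"
  using src_rng[of "ginv G a"] by (simp add: inv_closed)

lemma rng_mult_self [simp]: "a \<in> arrows G \<Longrightarrow> rng G a \<cdot> a = a"
  using inv_cancel_right[of a "ginv G a"] by (simp add: rng_def inv_inv composable_iff inv_closed src_def)

lemma mult_src_self [simp]: "a \<in> arrows G \<Longrightarrow> a \<cdot> src G a = a"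
  using inv_cancel_left[of "ginv G a" a] by (simp add: rng_def inv_inv composable_iff inv_closed src_def)

lemma unit_space_iff: "u \<in> unit_space G \<longleftrightarrow> u \<in> arrows G \<and> rng G u = u"
  by (auto simp: unit_space_def intro: rev_image_eqI)

lemma unit_rng: "u \<in> unit_space G \<Longrightarrow> rng G u = u"
  by (simp add: unit_space_iff)

lemma unit_in_arrows: "u \<in> unit_space G \<Longrightarrow> u \<in> arrows G"
  by (simp add: unit_space_iff)

lemma unit_src: "u \<in> unit_space G \<Longrightarrow> src G u = u"
  using src_rng[of u] by (simp add: unit_space_iff)

lemma rng_unit [simp]: "a \<in> arrows G \<Longrightarrow> rng G a \<in> unit_space G"
  by (simp add: unit_space_iff)

lemma src_unit [simp]: "a \<in> arrows G \<Longrightarrow> src G a \<in> unit_space G"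
  by (simp add: unit_space_iff)

lemma unit_inv: "u \<in> unit_space G \<Longrightarrow> ginv G u = u"
  using mult_src_self[of "ginv G u"] src_def[of G u]
  by (simp add: unit_space_iff inv_closed unit_src)

lemma unit_if_idem:
  assumes "u \<in> arrows G" "src G u = rng G u" "u \<cdot> u = u"
  shows "u \<in> unit_space G"
  using inv_mult_cancel[of u u] assms src_def[of G u] by (metis src_unit)

lemma left_inverse_unique:
  assumes "a \<in> arrows G" "b \<in> arrows G" "src G a = rng G b" "a \<cdot> b \<in> unit_space G"
  shows "a = ginv G b"
proof -
  have "a \<cdot> b = src G b"
    using src_mult[of a b] unit_src[OF assms(4)] assms by simp
  then show ?thesis
    using inv_cancel_right[of a b] mult_src_self[of "ginv G b"] assms
    by (metis composable_iff inv_closed rng_inv rng_mult_self)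
qed

end

lemma groupoid_hom_unit:
  assumes "groupoid G" "groupoid H" "groupoid_hom G H f" "u \<in> unit_space G"
  shows "f u \<in> unit_space H"
proof -
  interpret G: groupoid G by fact
  interpret H: groupoid H by fact
  have "(u, u) \<in> composable G"
    using assms(4) by (simp add: G.composable_iff G.unit_in_arrows G.unit_rng G.unit_src)
  then have "(f u, f u) \<in> composable H" "f (gmult G u u) = gmult H (f u) (f u)"
    using assms(3) by (auto simp: groupoid_hom_def)
  moreover have "gmult G u u = u"
    using assms(4) G.rng_mult_self[of u] by (simp add: G.unit_in_arrows G.unit_rng)
  ultimately show ?thesis
    using H.unit_if_idem[of "f u"] by (simp add: H.composable_iff)
qed

lemma groupoid_hom_inv:
  assumes "groupoid G" "groupoid H" "groupoid_hom G H f" "a \<in> arrows G"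
  shows "f (ginv G a) = ginv H (f a)"
proof -
  interpret G: groupoid G by fact
  interpret H: groupoid H by fact
  have "(ginv G a, a) \<in> composable G"
    using assms(4) by (simp add: G.composable_iff G.inv_closed)
  then have "(f (ginv G a), f a) \<in> composable H"
    "f (src G a) = gmult H (f (ginv G a)) (f a)"
    using assms(3) by (auto simp: groupoid_hom_def src_def)
  then show ?thesis
    using H.left_inverse_unique groupoid_hom_unit[OF assms(1-3), of "src G a"] assms(4)
    by (simp add: H.composable_iff)
qed

lemma groupoid_hom_rng:
  assumes "groupoid G" "groupoid H" "groupoid_hom G H f" "a \<in> arrows G"
  shows "f (rng G a) = rng H (f a)"
proof -
  have "(a, ginv G a) \<in> composable G"
    using assms(1,4) by (simp add: groupoid.composable_iff groupoid.inv_closed groupoid.rng_inv)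
  then show ?thesis
    using assms(3) groupoid_hom_inv[OF assms] by (auto simp: groupoid_hom_def rng_def)
qed

lemma groupoid_hom_src:
  assumes "groupoid G" "groupoid H" "groupoid_hom G H f" "a \<in> arrows G"
  shows "f (src G a) = src H (f a)"
proof -
  have "(ginv G a, a) \<in> composable G"
    using assms(1,4) by (simp add: groupoid.composable_iff groupoid.inv_closed groupoid.src_inv)
  then show ?thesis
    using assms(3) groupoid_hom_inv[OF assms] by (auto simp: groupoid_hom_def src_def)
qed


section \<open>Etale groupoids\<close>

lemma local_homeomorphism_imp_open_map:
  assumes "local_homeomorphism_map X Y f"
  shows "open_map X Y f"
  unfolding open_map_def
proof (intro allI impI)
  fix U assume U: "openin X U"
  show "openin Y (f ` U)"
  proof (subst openin_subopen, clarify)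
    fix x assume x: "x \<in> U"
    then have "x \<in> topspace X"
      using U openin_subset by blast
    then obtain N where N: "openin X N" "x \<in> N" "openin Y (f ` N)"
      and hom: "homeomorphic_map (subtopology X N) (subtopology Y (f ` N)) f"
      using assms unfolding local_homeomorphism_map_def by blast
    have "openin (subtopology Y (f ` N)) (f ` (U \<inter> N))"
      using homeomorphic_imp_open_map[OF hom] U
      by (simp add: open_map_def openin_subtopology_Int)
    then have "openin Y (f ` (U \<inter> N))"
      using N(3) openin_trans_full by blast
    then show "\<exists>T. openin Y T \<and> f x \<in> T \<and> T \<subseteq> f ` U"
      using x N(2) by blast
  qed
qed

context topological_groupoid
begin

lemma unit_space_subset: "unit_space G \<subseteq> topspace (gtop G)"
  using unit_in_arrows by (auto simp: arrows_def)

lemma topspace_unit_top [simp]: "topspace (unit_top G) = unit_space G"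
  using unit_space_subset by (auto simp: unit_top_def)

lemma continuous_map_rng: "continuous_map (gtop G) (gtop G) (rng G)"
proof -
  have "continuous_map (gtop G) (subtopology (prod_topology (gtop G) (gtop G)) (composable G))
      (\<lambda>a. (a, ginv G a))"
    using continuous_inv
    by (auto simp: continuous_map_in_subtopology continuous_map_pairedI composable_iff inv_closed
        arrows_def[symmetric])
  from continuous_map_compose[OF this continuous_mult] show ?thesis
    by (simp add: o_def rng_def[abs_def])
qed

lemma continuous_map_src: "continuous_map (gtop G) (gtop G) (src G)"
proof (rule continuous_map_eq)
  show "continuous_map (gtop G) (gtop G) (rng G \<circ> ginv G)"
    using continuous_inv continuous_map_rng continuous_map_compose by blast
qed (simp add: arrows_def[symmetric])

lemma openin_arrows: "openin (gtop G) U \<Longrightarrow> a \<in> U \<Longrightarrow> a \<in> arrows G"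
  using openin_subset by (fastforce simp: arrows_def)

lemma compactin_arrows: "compactin (gtop G) U \<Longrightarrow> a \<in> U \<Longrightarrow> a \<in> arrows G"
  using compactin_subset_topspace by (fastforce simp: arrows_def)

lemma openin_inv_preimage: "openin (gtop G) U \<Longrightarrow> openin (gtop G) {a \<in> arrows G. ginv G a \<in> U}"
  unfolding arrows_def by (rule openin_continuous_map_preimage[OF continuous_inv])

lemma openin_rng_preimage: "openin (gtop G) U \<Longrightarrow> openin (gtop G) {a \<in> arrows G. rng G a \<in> U}"
  unfolding arrows_def by (rule openin_continuous_map_preimage[OF continuous_map_rng])

lemma openin_src_preimage: "openin (gtop G) U \<Longrightarrow> openin (gtop G) {a \<in> arrows G. src G a \<in> U}"
  unfolding arrows_def by (rule openin_continuous_map_preimage[OF continuous_map_src])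

end

context etale_groupoid
begin

lemma open_map_src: "open_map (gtop G) (unit_top G) (src G)"
  by (rule local_homeomorphism_imp_open_map[OF src_local_homeomorphism])

text \<open>Around a unit pick an open set on which the source map is injective. An arrow of it whose
  source lies in it as well has the same source as that source, hence is a unit.\<close>

lemma openin_unit_space: "openin (gtop G) (unit_space G)"
proof (subst openin_subopen, clarify)
  fix u assume u: "u \<in> unit_space G"
  then obtain N where N: "openin (gtop G) N" "u \<in> N"
    and hom: "homeomorphic_map (subtopology (gtop G) N) (subtopology (unit_top G) (src G ` N)) (src G)"
    using src_local_homeomorphism unit_space_subset unfolding local_homeomorphism_map_def by blast
  have inj: "inj_on (src G) N"
    using homeomorphic_imp_injective_map[OF hom] N(1) openin_subset[of "gtop G" N]
    by (simp add: Int_absorb1)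
  let ?T = "N \<inter> {a \<in> arrows G. src G a \<in> N}"
  have "openin (gtop G) ?T"
    using N(1) openin_src_preimage by blast
  moreover have "u \<in> ?T"
    using u N(2) by (simp add: unit_in_arrows unit_src)
  moreover have "?T \<subseteq> unit_space G"
  proof
    fix a assume a: "a \<in> ?T"
    then have "src G a = a"
      using inj_onD[OF inj, of "src G a" a] by simp
    then show "a \<in> unit_space G"
      using a src_unit[of a] by simp
  qed
  ultimately show "\<exists>T. openin (gtop G) T \<and> u \<in> T \<and> T \<subseteq> unit_space G"
    by blast
qed

lemma openin_unit_top_iff: "openin (unit_top G) U \<longleftrightarrow> openin (gtop G) U \<and> U \<subseteq> unit_space G"
  unfolding unit_top_def by (rule openin_open_subtopology[OF openin_unit_space])

lemma openin_rng_image: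
  assumes U: "openin (gtop G) U"
  shows "openin (gtop G) (rng G ` U)"
proof -
  have "rng G ` U = src G ` {a \<in> arrows G. ginv G a \<in> U}"
  proof (intro equalityI subsetI)
    fix x assume "x \<in> rng G ` U"
    then obtain a where a: "a \<in> U" "x = rng G a" by blast
    then have "ginv G a \<in> {a \<in> arrows G. ginv G a \<in> U}" "src G (ginv G a) = x"
      using openin_arrows[OF U a(1)] by (auto simp: inv_closed inv_inv)
    then show "x \<in> src G ` {a \<in> arrows G. ginv G a \<in> U}" by blast
  next
    fix x assume "x \<in> src G ` {a \<in> arrows G. ginv G a \<in> U}"
    then obtain a where "a \<in> arrows G" "ginv G a \<in> U" "x = src G a" by blast
    then show "x \<in> rng G ` U"
      by (metis imageI rng_inv)
  qed
  then show ?thesis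
    using open_map_src openin_inv_preimage[OF U] openin_unit_top_iff
    unfolding open_map_def by metis
qed

end


section \<open>Bisections and effectiveness\<close>

lemma open_bisection_inj:
  assumes "open_bisection G B"
  shows "inj_on (rng G) B"
proof -
  have "homeomorphic_map (subtopology (gtop G) B) (subtopology (unit_top G) (rng G ` B)) (rng G)"
    and B: "openin (gtop G) B"
    using assms by (auto simp: open_bisection_def)
  from homeomorphic_imp_injective_map[OF this(1)] openin_subset[OF B] show ?thesis
    by (simp add: Int_absorb1)
qed

lemma (in topological_groupoid) Hausdorff_separate:
  assumes "Hausdorff_space (gtop G)" "a \<in> arrows G" "b \<in> arrows G" "a \<noteq> b"
  obtains U V where "openin (gtop G) U" "openin (gtop G) V" "a \<in> U" "b \<in> V" "disjnt U V"
  using assms unfolding Hausdorff_space_def arrows_def by blast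

text \<open>Near a non-unit \<open>a\<close> arrows stay close to \<open>a\<close> and their ranges close to \<open>rng G a\<close>, which is a different
  point; a unit would have to be close to both.\<close>

lemma (in topological_groupoid) Hausdorff_separate_from_units:
  assumes "Hausdorff_space (gtop G)" "a \<in> arrows G" "a \<notin> unit_space G"
  obtains N where "openin (gtop G) N" "a \<in> N" "N \<inter> unit_space G = {}"
proof -
  have "a \<noteq> rng G a"
    using assms(2,3) rng_unit by metis
  then obtain U V where UV: "openin (gtop G) U" "openin (gtop G) V" "a \<in> U" "rng G a \<in> V" "disjnt U V"
    using Hausdorff_separate[OF assms(1,2) rng_in_arrows[OF assms(2)]] by blast
  let ?N = "U \<inter> {b \<in> arrows G. rng G b \<in> V}"
  show ?thesis
  proof
    show "openin (gtop G) ?N"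
      using UV openin_rng_preimage by blast
    show "a \<in> ?N"
      using UV assms by blast
    show "?N \<inter> unit_space G = {}"
      using UV(5) by (auto simp: disjnt_iff unit_rng)
  qed
qed

text \<open>Where effectiveness enters. If the arrows of \<open>B\<close> with both ends in \<open>U\<close> were all isotropic, they
  would form an open set of isotropy, hence consist of units. So one of them, \<open>b\<close>, has distinct ends,
  which are separated by disjoint open sets. The ranges of the arrows of \<open>B\<close> close to \<open>b\<close> form
  the required set: by injectivity of the range map, an arrow of \<open>B\<close> that ends there is
  close to \<open>b\<close> and therefore does not start there.\<close>

lemma (in etale_groupoid) effective_avoid_bisection:
  assumes "Hausdorff_space (gtop G)" "effective G"
    and B: "openin (gtop G) B" "inj_on (rng G) B" "B \<inter> unit_space G = {}"
    and U: "openin (gtop G) U" "U \<noteq> {}" "U \<subseteq> unit_space G"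
  obtains V where "openin (gtop G) V" "V \<noteq> {}" "V \<subseteq> U"
    "\<And>b. \<lbrakk>b \<in> B; rng G b \<in> V\<rbrakk> \<Longrightarrow> src G b \<notin> V"
proof -
  define C where "C = B \<inter> {b \<in> arrows G. rng G b \<in> U} \<inter> {b \<in> arrows G. src G b \<in> U}"
  have C: "openin (gtop G) C"
    unfolding C_def using B(1) U(1) openin_rng_preimage openin_src_preimage by blast
  show ?thesis
  proof (cases "C = {}")
    case True
    show ?thesis
    proof
      show "src G b \<notin> U" if "b \<in> B" "rng G b \<in> U" for b
        using True that openin_arrows[OF B(1)] by (auto simp: C_def)
    qed (use U in auto)
  next
    case False
    have "\<not> C \<subseteq> iso G"
    proof
      assume "C \<subseteq> iso G"
      then have "C \<subseteq> unit_space G"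
        using interior_of_maximal[OF _ C, of "iso G"] assms(2) by (simp add: effective_def)
      then show False
        using False B(3) by (auto simp: C_def)
    qed
    then obtain b where b: "b \<in> C" "rng G b \<noteq> src G b"
      by (auto simp: C_def iso_def)
    then have "b \<in> arrows G" by (simp add: C_def)
    then obtain V1 V2 where V: "openin (gtop G) V1" "openin (gtop G) V2" "rng G b \<in> V1"
      "src G b \<in> V2" "disjnt V1 V2"
      using Hausdorff_separate[OF assms(1) rng_in_arrows src_in_arrows] b(2) by metis
    \<comment> \<open>the arrows of \<open>C\<close> close to \<open>b\<close>, in that their ends are separated in the same way\<close>
    define D where "D = C \<inter> {b \<in> arrows G. rng G b \<in> V1} \<inter> {b \<in> arrows G. src G b \<in> V2}"
    have D: "openin (gtop G) D"
      unfolding D_def using C V openin_rng_preimage openin_src_preimage by blast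
    show ?thesis
    proof
      show "openin (gtop G) (rng G ` D)"
        using openin_rng_image[OF D] .
      show "rng G ` D \<noteq> {}"
        using b \<open>b \<in> arrows G\<close> V by (auto simp: D_def)
      show "rng G ` D \<subseteq> U"
        by (auto simp: D_def C_def)
      fix c assume c: "c \<in> B" "rng G c \<in> rng G ` D"
      then obtain d where d: "d \<in> D" "rng G c = rng G d" by blast
      then have "c = d"
        using inj_onD[OF B(2) d(2) c(1)] by (simp add: D_def C_def)
      then have "c \<in> D" using d(1) by simp
      then show "src G c \<notin> rng G ` D"
        using V(5) by (auto simp: D_def disjnt_iff)
    qed
  qed
qed

context ample_groupoid
begin

text \<open>Each of the finitely many bisections that cover \<open>K\<close> contains at most one arrow with range \<open>x\<close>.\<close>

lemma finite_compact_fibre: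
  assumes "compactin (gtop G) K"
  shows "finite {a \<in> K. rng G a = x}"
proof -
  have "K \<subseteq> \<Union>{B. open_bisection G B}"
  proof
    fix a assume "a \<in> K"
    then have "a \<in> topspace (gtop G)"
      using compactin_subset_topspace[OF assms] by blast
    then show "a \<in> \<Union>{B. open_bisection G B}"
      using compact_open_bisection_basis[OF openin_topspace] by blast
  qed
  then obtain F where F: "finite F" "F \<subseteq> {B. open_bisection G B}" "K \<subseteq> \<Union>F"
    using compactinD[OF assms, of "{B. open_bisection G B}"] by (auto simp: open_bisection_def)
  have "finite {a \<in> B. rng G a \<in> {x}}" if "B \<in> F" for B
    using F(2) that by (intro finite_inverse_image_gen open_bisection_inj) auto
  then have "finite (\<Union>B\<in>F. {a \<in> B. rng G a \<in> {x}})"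
    using F(1) by blast
  then show ?thesis
    by (rule rev_finite_subset) (use F(3) in auto)
qed

text \<open>A compact set of non-units is covered by finitely many bisections free of units, which are
  avoided one after the other.\<close>

lemma effective_avoid_compact:
  assumes H: "Hausdorff_space (gtop G)" and eff: "effective G"
    and K: "compactin (gtop G) K" "K \<inter> unit_space G = {}"
    and U: "openin (gtop G) U" "U \<noteq> {}" "U \<subseteq> unit_space G"
  obtains V where "openin (gtop G) V" "V \<noteq> {}" "V \<subseteq> U"
    "\<And>b. \<lbrakk>b \<in> K; rng G b \<in> V\<rbrakk> \<Longrightarrow> src G b \<notin> V"
proof -
  let ?\<B> = "{B. open_bisection G B \<and> B \<inter> unit_space G = {}}"
  have "K \<subseteq> \<Union>?\<B>"
  proof
    fix a assume a: "a \<in> K"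
    then obtain N where "openin (gtop G) N" "a \<in> N" "N \<inter> unit_space G = {}"
      using Hausdorff_separate_from_units[OF H] K compactin_arrows by blast
    then show "a \<in> \<Union>?\<B>"
      using compact_open_bisection_basis[of N a] by blast
  qed
  then obtain F where F: "finite F" "F \<subseteq> ?\<B>" "K \<subseteq> \<Union>F"
    using compactinD[OF K(1), of ?\<B>] by (auto simp: open_bisection_def)
  have "\<exists>V. openin (gtop G) V \<and> V \<noteq> {} \<and> V \<subseteq> U \<and>
      (\<forall>b\<in>\<Union>F. rng G b \<in> V \<longrightarrow> src G b \<notin> V)"
    using F(1,2)
  proof (induction F rule: finite_induct)
    case empty
    then show ?case using U by auto
  next
    case (insert B F)
    then obtain V where V: "openin (gtop G) V" "V \<noteq> {}" "V \<subseteq> U"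
      "\<forall>b\<in>\<Union>F. rng G b \<in> V \<longrightarrow> src G b \<notin> V"
      by auto
    have "openin (gtop G) B" "inj_on (rng G) B" "B \<inter> unit_space G = {}"
      using insert.prems open_bisection_inj by (auto simp: open_bisection_def)
    from effective_avoid_bisection[OF H eff this V(1,2) subset_trans[OF V(3) U(3)]]
    obtain V' where V': "openin (gtop G) V'" "V' \<noteq> {}" "V' \<subseteq> V"
      "\<And>b. \<lbrakk>b \<in> B; rng G b \<in> V'\<rbrakk> \<Longrightarrow> src G b \<notin> V'"
      by metis
    have "src G b \<notin> V'" if "b \<in> \<Union>(insert B F)" "rng G b \<in> V'" for b
    proof (cases "b \<in> B")
      case True
      then show ?thesis using V'(4) that(2) by blast
    next
      case False
      then have "src G b \<notin> V"
        using V(4) V'(3) that by blast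
      then show ?thesis using V'(3) by blast
    qed
    then show ?case
      using V' V(3) by (intro exI[of _ V']) auto
  qed
  then obtain V where "openin (gtop G) V" "V \<noteq> {}" "V \<subseteq> U"
    "\<forall>b\<in>\<Union>F. rng G b \<in> V \<longrightarrow> src G b \<notin> V"
    by blast
  then show ?thesis
    using F(3) by (intro that[of V]) auto
qed

end


section \<open>Discrete twists\<close>

lemma unit_inv_eqI:
  fixes t :: "'r::{comm_ring, comm_monoid_mult}"
  assumes "t * u = 1"
  shows "unit_inv t = u"
  unfolding unit_inv_def
proof (rule the_equality)
  show "t * u = 1" by (rule assms)
next
  fix v assume v: "t * v = 1"
  have "v = v * (t * u)" using assms by simp
  also have "\<dots> = (t * v) * u" by (simp only: ac_simps)
  finally show "v = u" using v by simp
qed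

lemma ring_units_inverse:
  fixes t :: "'r::{comm_ring, comm_monoid_mult}"
  assumes "t \<in> ring_units"
  shows unit_inv_in_ring_units: "unit_inv t \<in> ring_units"
    and mult_unit_inv: "t * unit_inv t = 1"
    and unit_inv_mult: "unit_inv t * t = 1"
    and unit_inv_unit_inv: "unit_inv (unit_inv t) = t"
proof -
  obtain u where u: "t * u = 1"
    using assms by (metis dvdE mem_Collect_eq ring_units_def)
  then have *: "unit_inv t = u" by (rule unit_inv_eqI)
  have ut: "u * t = 1" using u by (simp add: mult.commute)
  show "unit_inv t \<in> ring_units" "t * unit_inv t = 1" "unit_inv t * t = 1"
    using u ut by (auto simp: * ring_units_def intro: dvdI[of _ _ t])
  show "unit_inv (unit_inv t) = t"
    unfolding * using ut by (rule unit_inv_eqI)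
qed

lemma one_in_ring_units [simp]: "(1 :: 'r::{comm_ring, comm_monoid_mult}) \<in> ring_units"
  by (simp add: ring_units_def)

lemma unit_inv_1 [simp]: "unit_inv (1 :: 'r::{comm_ring, comm_monoid_mult}) = 1"
  by (rule unit_inv_eqI) simp

lemma mult_in_ring_units:
  fixes t u :: "'r::{comm_ring, comm_monoid_mult}"
  assumes "t \<in> ring_units" "u \<in> ring_units"
  shows "t * u \<in> ring_units" and unit_inv_of_mult: "unit_inv (t * u) = unit_inv u * unit_inv t"
proof -
  have "(t * u) * (unit_inv u * unit_inv t) = (t * unit_inv t) * (u * unit_inv u)"
    by (simp only: ac_simps)
  then have *: "(t * u) * (unit_inv u * unit_inv t) = 1"
    using assms by (simp add: mult_unit_inv)
  then show "t * u \<in> ring_units"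
    unfolding ring_units_def by (metis dvdI mem_Collect_eq)
  show "unit_inv (t * u) = unit_inv u * unit_inv t"
    using * by (rule unit_inv_eqI)
qed

lemma unit_inv_mult_eq_0_iff:
  fixes t r :: "'r::{comm_ring, comm_monoid_mult}"
  assumes "t \<in> ring_units"
  shows "unit_inv t * r = 0 \<longleftrightarrow> r = 0"
proof
  assume "unit_inv t * r = 0"
  then have "t * (unit_inv t * r) = 0" by simp
  then show "r = 0" using mult_unit_inv[OF assms] by (simp add: mult.assoc[symmetric])
qed simp

lemma arrows_trivial_bundle [simp]:
  "topological_groupoid G \<Longrightarrow> arrows (trivial_bundle G) = unit_space G \<times> ring_units"
  by (simp add: arrows_def trivial_bundle_def topological_groupoid.topspace_unit_top)

lemma openin_locally_constant:
  assumes "locally_constant_on X f"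
  shows "openin X {x \<in> topspace X. P (f x)}"
proof (subst openin_subopen, clarify)
  fix x assume x: "x \<in> topspace X" "P (f x)"
  then obtain U where U: "openin X U" "x \<in> U" "\<forall>y\<in>U. f y = f x"
    using assms unfolding locally_constant_on_def by blast
  have "P (f y)" if "y \<in> U" for y
    using bspec[OF U(3) that] x(2) by (simp only:)
  then have "U \<subseteq> {x \<in> topspace X. P (f x)}"
    using openin_subset[OF U(1)] by blast
  then show "\<exists>T. openin X T \<and> x \<in> T \<and> T \<subseteq> {x \<in> topspace X. P (f x)}"
    using U(1,2) by blast
qed

context discrete_twist
begin

abbreviation (input)
  "act \<equiv> twist_act \<Sigma> i q"

lemma i_mult:
  assumes "x \<in> unit_space G" "t \<in> ring_units" "u \<in> ring_units"
  shows "(i (x, t), i (x, u)) \<in> composable \<Sigma>" "gmult \<Sigma> (i (x, t)) (i (x, u)) = i (x, t * u)"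
proof -
  have "src (trivial_bundle G) (x, t) = rng (trivial_bundle G) (x, u)"
    using assms by (simp add: src_def rng_def trivial_bundle_def mult_unit_inv unit_inv_mult)
  then have "((x, t), (x, u)) \<in> composable (trivial_bundle G)"
    using assms
    by (simp add: composable_def arrows_trivial_bundle[OF G.topological_groupoid_axioms])
  then show "(i (x, t), i (x, u)) \<in> composable \<Sigma>" "gmult \<Sigma> (i (x, t)) (i (x, u)) = i (x, t * u)"
    using i_hom by (auto simp: groupoid_hom_def trivial_bundle_def)
qed

lemma i_in_arrows: "\<lbrakk>x \<in> unit_space G; t \<in> ring_units\<rbrakk> \<Longrightarrow> i (x, t) \<in> arrows \<Sigma>"
  using i_mult(1) S.composable_iff by blast

lemma q_i: "\<lbrakk>x \<in> unit_space G; t \<in> ring_units\<rbrakk> \<Longrightarrow> q (i (x, t)) = x"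
  using fibre_over_unit[of x] by blast

lemma i_one_unit: "x \<in> unit_space G \<Longrightarrow> i (x, 1) \<in> unit_space \<Sigma>"
  using unit_space_twist by simp

lemma rng_i: "\<lbrakk>x \<in> unit_space G; t \<in> ring_units\<rbrakk> \<Longrightarrow> rng \<Sigma> (i (x, t)) = i (x, 1)"
  using i_mult(1)[of x 1 t] S.unit_src[OF i_one_unit] by (simp add: S.composable_iff)

lemma src_i: "\<lbrakk>x \<in> unit_space G; t \<in> ring_units\<rbrakk> \<Longrightarrow> src \<Sigma> (i (x, t)) = i (x, 1)"
  using i_mult(1)[of x t 1] S.unit_rng[OF i_one_unit] by (simp add: S.composable_iff)

lemma i_q_unit:
  assumes "u \<in> unit_space \<Sigma>"
  shows "i (q u, 1) = u" "q u \<in> unit_space G"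
  using assms unit_space_twist q_i by auto

lemma inj_on_q_unit_space: "inj_on q (unit_space \<Sigma>)"
  by (metis inj_onI i_q_unit(1))

lemma q_in_arrows [simp]: "\<sigma> \<in> arrows \<Sigma> \<Longrightarrow> q \<sigma> \<in> arrows G"
  using q_surj by blast

lemma q_rng: "\<sigma> \<in> arrows \<Sigma> \<Longrightarrow> q (rng \<Sigma> \<sigma>) = rng G (q \<sigma>)"
  using groupoid_hom_rng[OF S.groupoid_axioms G.groupoid_axioms q_hom] .

lemma q_src: "\<sigma> \<in> arrows \<Sigma> \<Longrightarrow> q (src \<Sigma> \<sigma>) = src G (q \<sigma>)"
  using groupoid_hom_src[OF S.groupoid_axioms G.groupoid_axioms q_hom] .

lemma q_inv: "\<sigma> \<in> arrows \<Sigma> \<Longrightarrow> q (ginv \<Sigma> \<sigma>) = ginv G (q \<sigma>)"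
  using groupoid_hom_inv[OF S.groupoid_axioms G.groupoid_axioms q_hom] .

lemma q_mult:
  "\<lbrakk>\<sigma> \<in> arrows \<Sigma>; \<tau> \<in> arrows \<Sigma>; src \<Sigma> \<sigma> = rng \<Sigma> \<tau>\<rbrakk> \<Longrightarrow> q (gmult \<Sigma> \<sigma> \<tau>) = gmult G (q \<sigma>) (q \<tau>)"
  using q_hom by (auto simp: groupoid_hom_def S.composable_iff)

lemma rng_eq_iff:
  "\<lbrakk>\<sigma> \<in> arrows \<Sigma>; \<tau> \<in> arrows \<Sigma>\<rbrakk> \<Longrightarrow> rng G (q \<sigma>) = rng G (q \<tau>) \<longleftrightarrow> rng \<Sigma> \<sigma> = rng \<Sigma> \<tau>"
  using inj_on_eq_iff[OF inj_on_q_unit_space, of "rng \<Sigma> \<sigma>" "rng \<Sigma> \<tau>"] by (simp add: q_rng)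

lemma src_eq_iff:
  "\<lbrakk>\<sigma> \<in> arrows \<Sigma>; \<tau> \<in> arrows \<Sigma>\<rbrakk> \<Longrightarrow> src G (q \<sigma>) = src G (q \<tau>) \<longleftrightarrow> src \<Sigma> \<sigma> = src \<Sigma> \<tau>"
  using inj_on_eq_iff[OF inj_on_q_unit_space, of "src \<Sigma> \<sigma>" "src \<Sigma> \<tau>"] by (simp add: q_src)

lemma act_basics:
  assumes "\<sigma> \<in> arrows \<Sigma>" "t \<in> ring_units"
  shows act_in_arrows: "act t \<sigma> \<in> arrows \<Sigma>" and rng_act: "rng \<Sigma> (act t \<sigma>) = rng \<Sigma> \<sigma>"
    and src_act: "src \<Sigma> (act t \<sigma>) = src \<Sigma> \<sigma>" and q_act: "q (act t \<sigma>) = q \<sigma>"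
proof -
  let ?j = "i (q (rng \<Sigma> \<sigma>), t)"
  have u: "rng \<Sigma> \<sigma> \<in> unit_space \<Sigma>" using assms by simp
  note iq = i_q_unit[OF u]
  have j: "?j \<in> arrows \<Sigma>" "src \<Sigma> ?j = rng \<Sigma> \<sigma>" "rng \<Sigma> ?j = rng \<Sigma> \<sigma>"
    using iq assms by (simp_all add: i_in_arrows src_i rng_i)
  show "act t \<sigma> \<in> arrows \<Sigma>" "rng \<Sigma> (act t \<sigma>) = rng \<Sigma> \<sigma>" "src \<Sigma> (act t \<sigma>) = src \<Sigma> \<sigma>"
    using j assms by (simp_all add: twist_act_def)
  show "q (act t \<sigma>) = q \<sigma>"
    using j assms iq by (simp add: twist_act_def q_mult q_i) (simp add: q_rng)
qed

lemma act_one: "\<sigma> \<in> arrows \<Sigma> \<Longrightarrow> act 1 \<sigma> = \<sigma>"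
  by (simp add: twist_act_def i_q_unit)

lemma act_mult_left:
  assumes "\<sigma> \<in> arrows \<Sigma>" "\<tau> \<in> arrows \<Sigma>" "src \<Sigma> \<sigma> = rng \<Sigma> \<tau>" "t \<in> ring_units"
  shows "gmult \<Sigma> (act t \<sigma>) \<tau> = act t (gmult \<Sigma> \<sigma> \<tau>)"
  using assms i_q_unit[of "rng \<Sigma> \<sigma>"]
  by (simp add: twist_act_def S.mult_assoc i_in_arrows src_i)

lemma act_act:
  assumes "\<sigma> \<in> arrows \<Sigma>" "t \<in> ring_units" "u \<in> ring_units"
  shows "act t (act u \<sigma>) = act (t * u) \<sigma>"
proof -
  have x: "q (rng \<Sigma> \<sigma>) \<in> unit_space G" "i (q (rng \<Sigma> \<sigma>), 1) = rng \<Sigma> \<sigma>"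
    using assms i_q_unit[of "rng \<Sigma> \<sigma>"] by simp_all
  have "act t (act u \<sigma>) = gmult \<Sigma> (i (q (rng \<Sigma> \<sigma>), t)) (gmult \<Sigma> (i (q (rng \<Sigma> \<sigma>), u)) \<sigma>)"
    using rng_act[OF assms(1,3)] by (simp add: twist_act_def)
  also have "\<dots> = gmult \<Sigma> (gmult \<Sigma> (i (q (rng \<Sigma> \<sigma>), t)) (i (q (rng \<Sigma> \<sigma>), u))) \<sigma>"
    using x assms by (simp add: S.mult_assoc i_in_arrows src_i rng_i)
  also have "\<dots> = act (t * u) \<sigma>"
    using x assms by (simp add: i_mult twist_act_def)
  finally show ?thesis .
qed

text \<open>Scalars can be moved past an arrow on its left because the image of \<open>i\<close> is central.\<close>

lemma act_mult_right:
  assumes "\<sigma> \<in> arrows \<Sigma>" "\<tau> \<in> arrows \<Sigma>" "src \<Sigma> \<sigma> = rng \<Sigma> \<tau>" "t \<in> ring_units"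
  shows "gmult \<Sigma> \<sigma> (act t \<tau>) = act t (gmult \<Sigma> \<sigma> \<tau>)"
proof -
  have x: "q (rng \<Sigma> \<tau>) \<in> unit_space G" "i (q (rng \<Sigma> \<tau>), 1) = rng \<Sigma> \<tau>"
    using assms i_q_unit[of "rng \<Sigma> \<tau>"] by simp_all
  have "gmult \<Sigma> \<sigma> (act t \<tau>) = gmult \<Sigma> (gmult \<Sigma> \<sigma> (i (q (src \<Sigma> \<sigma>), t))) \<tau>"
    using x assms by (simp add: twist_act_def S.mult_assoc i_in_arrows src_i rng_i)
  also have "\<dots> = gmult \<Sigma> (act t \<sigma>) \<tau>"
    using assms by (simp add: central twist_act_def)
  finally show ?thesis
    using act_mult_left[OF assms] by simp
qed

lemma act_inv_act:
  assumes "\<sigma> \<in> arrows \<Sigma>" "t \<in> ring_units"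
  shows "act (unit_inv t) (act t \<sigma>) = \<sigma>" "act t (act (unit_inv t) \<sigma>) = \<sigma>"
  using assms by (simp_all add: act_act unit_inv_in_ring_units mult_unit_inv unit_inv_mult act_one)

text \<open>Multiplying by the inverse of \<open>\<sigma>\<close> recovers the arrow \<open>i (x, t)\<close>, and \<open>i\<close> is injective.\<close>

lemma act_free:
  assumes "\<sigma> \<in> arrows \<Sigma>" "t \<in> ring_units" "u \<in> ring_units" "act t \<sigma> = act u \<sigma>"
  shows "t = u"
proof -
  have x: "q (rng \<Sigma> \<sigma>) \<in> unit_space G" "i (q (rng \<Sigma> \<sigma>), 1) = rng \<Sigma> \<sigma>"
    using assms i_q_unit[of "rng \<Sigma> \<sigma>"] by simp_all
  have "gmult \<Sigma> (act v \<sigma>) (ginv \<Sigma> \<sigma>) = i (q (rng \<Sigma> \<sigma>), v)" if "v \<in> ring_units" for v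
    using S.inv_cancel_right[of "i (q (rng \<Sigma> \<sigma>), v)" \<sigma>] x that assms
    by (simp add: S.composable_iff twist_act_def i_in_arrows src_i)
  then have "i (q (rng \<Sigma> \<sigma>), t) = i (q (rng \<Sigma> \<sigma>), u)"
    using assms by metis
  then show ?thesis
    using inj_onD[OF i_inj, of "(q (rng \<Sigma> \<sigma>), t)" "(q (rng \<Sigma> \<sigma>), u)"] x(1) assms by simp
qed

text \<open>If \<open>\<sigma>\<close> and \<open>\<tau>\<close> have the same image under \<open>q\<close>, their quotient is mapped to a unit by \<open>q\<close>, so it belongs to
  the image of \<open>i\<close>.\<close>

lemma act_transitive:
  assumes "\<sigma> \<in> arrows \<Sigma>" "\<tau> \<in> arrows \<Sigma>" "q \<sigma> = q \<tau>"
  obtains t where "t \<in> ring_units" "\<tau> = act t \<sigma>"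
proof -
  have eq: "src \<Sigma> \<sigma> = src \<Sigma> \<tau>" "rng \<Sigma> \<sigma> = rng \<Sigma> \<tau>"
    using assms by (simp_all flip: src_eq_iff rng_eq_iff)
  let ?\<rho> = "gmult \<Sigma> \<tau> (ginv \<Sigma> \<sigma>)"
  have "?\<rho> \<in> arrows \<Sigma>"
    using assms eq by (simp add: S.inv_closed)
  moreover have "q ?\<rho> = q (rng \<Sigma> \<sigma>)"
    using assms eq by (simp add: q_mult q_inv S.inv_closed q_rng) (simp add: rng_def)
  moreover have "q (rng \<Sigma> \<sigma>) \<in> unit_space G"
    using assms i_q_unit[of "rng \<Sigma> \<sigma>"] by simp
  ultimately obtain t where t: "t \<in> ring_units" "?\<rho> = i (q (rng \<Sigma> \<sigma>), t)"
    using fibre_over_unit[of "q (rng \<Sigma> \<sigma>)"] by blast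
  have "act t \<sigma> = gmult \<Sigma> ?\<rho> \<sigma>"
    using t by (simp add: twist_act_def)
  also have "\<dots> = \<tau>"
    using S.inv_cancel_right[of \<tau> "ginv \<Sigma> \<sigma>"] assms eq
    by (simp add: S.composable_iff S.inv_closed S.inv_inv)
  finally show ?thesis
    using that t(1) by blast
qed

lemma openin_q_preimage: "openin (gtop G) U \<Longrightarrow> openin (gtop \<Sigma>) {\<sigma> \<in> arrows \<Sigma>. q \<sigma> \<in> U}"
  unfolding arrows_def by (rule openin_continuous_map_preimage[OF q_continuous])

lemma continuous_map_act:
  assumes "t \<in> ring_units"
  shows "continuous_map (gtop \<Sigma>) (gtop \<Sigma>) (act t)"
proof -
  have "continuous_map (gtop \<Sigma>) (gtop G) (\<lambda>\<sigma>. q (rng \<Sigma> \<sigma>))"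
    using continuous_map_compose[OF S.continuous_map_rng q_continuous] by (simp add: o_def)
  then have "continuous_map (gtop \<Sigma>) (unit_top G) (\<lambda>\<sigma>. q (rng \<Sigma> \<sigma>))"
    by (auto simp: unit_top_def continuous_map_in_subtopology arrows_def[symmetric] q_rng)
  then have "continuous_map (gtop \<Sigma>) (gtop (trivial_bundle G)) (\<lambda>\<sigma>. (q (rng \<Sigma> \<sigma>), t))"
    using assms by (simp add: trivial_bundle_def continuous_map_pairedI)
  from continuous_map_compose[OF this i_continuous]
  have "continuous_map (gtop \<Sigma>) (gtop \<Sigma>) (\<lambda>\<sigma>. i (q (rng \<Sigma> \<sigma>), t))"
    by (simp add: o_def)
  moreover have "(i (q (rng \<Sigma> \<sigma>), t), \<sigma>) \<in> composable \<Sigma>" if "\<sigma> \<in> arrows \<Sigma>" for \<sigma>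
    using that assms i_q_unit[of "rng \<Sigma> \<sigma>"] by (simp add: S.composable_iff i_in_arrows src_i)
  ultimately have "continuous_map (gtop \<Sigma>)
      (subtopology (prod_topology (gtop \<Sigma>) (gtop \<Sigma>)) (composable \<Sigma>)) (\<lambda>\<sigma>. (i (q (rng \<Sigma> \<sigma>), t), \<sigma>))"
    by (auto simp: continuous_map_in_subtopology continuous_map_pairedI arrows_def[symmetric])
  from continuous_map_compose[OF this S.continuous_mult] show ?thesis
    by (simp add: o_def twist_act_def[abs_def])
qed

lemma openin_act:
  assumes "openin (gtop \<Sigma>) U" "t \<in> ring_units"
  shows "openin (gtop \<Sigma>) (act t ` U)"
proof -
  have "act t ` U = {\<sigma> \<in> topspace (gtop \<Sigma>). act (unit_inv t) \<sigma> \<in> U}"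
  proof (intro equalityI subsetI)
    fix \<sigma> assume "\<sigma> \<in> act t ` U"
    then show "\<sigma> \<in> {\<sigma> \<in> topspace (gtop \<Sigma>). act (unit_inv t) \<sigma> \<in> U}"
      using S.openin_arrows[OF assms(1)] assms(2)
      by (auto simp: act_inv_act act_in_arrows arrows_def[symmetric])
  next
    fix \<sigma> assume "\<sigma> \<in> {\<sigma> \<in> topspace (gtop \<Sigma>). act (unit_inv t) \<sigma> \<in> U}"
    then show "\<sigma> \<in> act t ` U"
      using act_inv_act(2)[of \<sigma> t] assms(2) by (force simp: arrows_def[symmetric] image_iff)
  qed
  then show ?thesis
    using openin_continuous_map_preimage[OF continuous_map_act[OF unit_inv_in_ring_units] assms(1)]
      assms(2) by simp
qed

text \<open>Translating the section of a local trivialization by a scalar makes it pass through a given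
  arrow of the twist.\<close>

lemma local_section:
  assumes \<sigma>: "\<sigma> \<in> arrows \<Sigma>"
  obtains B p where "open_bisection G B" "q \<sigma> \<in> B"
    "continuous_map (subtopology (gtop G) B) (gtop \<Sigma>) p" "\<And>\<beta>. \<beta> \<in> B \<Longrightarrow> q (p \<beta>) = \<beta>" "p (q \<sigma>) = \<sigma>"
    "\<And>B'. \<lbrakk>openin (gtop G) B'; B' \<subseteq> B\<rbrakk> \<Longrightarrow> openin (gtop \<Sigma>) (p ` B')"
proof -
  obtain B P where B: "open_bisection G B" "q \<sigma> \<in> B"
    and P: "continuous_map (subtopology (gtop G) B) (gtop \<Sigma>) P" "\<forall>\<beta>\<in>B. q (P \<beta>) = \<beta>"
    and hom: "homeomorphic_map
             (prod_topology (subtopology (gtop G) B) (discrete_topology ring_units))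
             (subtopology (gtop \<Sigma>) {\<sigma> \<in> arrows \<Sigma>. q \<sigma> \<in> B})
             (\<lambda>(\<beta>, t). gmult \<Sigma> (i (rng G \<beta>, t)) (P \<beta>))"
    using local_trivialization[OF q_in_arrows[OF \<sigma>]] by blast
  let ?\<phi> = "\<lambda>(\<beta>, t). gmult \<Sigma> (i (rng G \<beta>, t)) (P \<beta>)"
  let ?Q = "{\<sigma> \<in> arrows \<Sigma>. q \<sigma> \<in> B}"
  have oB: "openin (gtop G) B" using B(1) by (simp add: open_bisection_def)
  have topB: "topspace (subtopology (gtop G) B) = B"
    using openin_subset[OF oB] by auto
  have oQ: "openin (gtop \<Sigma>) ?Q" by (rule openin_q_preimage[OF oB])
  have P_arrows: "P \<beta> \<in> arrows \<Sigma>" if "\<beta> \<in> B" for \<beta>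
    using continuous_map_image_subset_topspace[OF P(1)] that topB by (auto simp: arrows_def)
  have \<phi>: "?\<phi> (\<beta>, t) = act t (P \<beta>)" if "\<beta> \<in> B" for \<beta> t
    using P(2) P_arrows[OF that] that by (simp add: twist_act_def q_rng)
  have "?\<phi> ` (B \<times> ring_units) = ?Q"
    using homeomorphic_imp_surjective_map[OF hom] openin_subset[OF oQ] openin_subset[OF oB]
    by (simp add: Int_absorb1)
  then obtain \<beta> t where t: "\<beta> \<in> B" "t \<in> ring_units" "\<sigma> = ?\<phi> (\<beta>, t)"
    using \<sigma> B(2) by blast
  then have \<beta>: "\<beta> = q \<sigma>"
    using \<phi>[of \<beta> t] P(2) q_act[OF P_arrows] by auto
  show ?thesis
  proof (rule that[OF B])
    let ?p = "\<lambda>\<beta>. ?\<phi> (\<beta>, t)"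
    have "continuous_map (subtopology (gtop G) B)
        (prod_topology (subtopology (gtop G) B) (discrete_topology ring_units)) (\<lambda>\<beta>. (\<beta>, t))"
      using t(2) by (simp add: continuous_map_pairedI)
    from continuous_map_compose[OF this homeomorphic_imp_continuous_map[OF hom]]
    show "continuous_map (subtopology (gtop G) B) (gtop \<Sigma>) ?p"
      by (simp add: o_def continuous_map_in_subtopology)
    show "q (?p \<beta>) = \<beta>" if "\<beta> \<in> B" for \<beta>
      using \<phi>[OF that] P(2) q_act[OF P_arrows t(2)] that by simp
    show "?p (q \<sigma>) = \<sigma>"
      using t(3) \<beta> by simp
    show "openin (gtop \<Sigma>) (?p ` B')" if B': "openin (gtop G) B'" "B' \<subseteq> B" for B'
    proof -
      have "openin (subtopology (gtop G) B) B'"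
        using B' oB by (simp add: openin_open_subtopology)
      then have "openin (prod_topology (subtopology (gtop G) B) (discrete_topology ring_units)) (B' \<times> {t})"
        using t(2) by (simp add: openin_prod_Times_iff)
      then have "openin (subtopology (gtop \<Sigma>) ?Q) (?\<phi> ` (B' \<times> {t}))"
        using homeomorphic_imp_open_map[OF hom] unfolding open_map_def by blast
      then have "openin (gtop \<Sigma>) (?\<phi> ` (B' \<times> {t}))"
        by (rule openin_trans_full[OF _ oQ])
      moreover have "?\<phi> ` (B' \<times> {t}) = ?p ` B'"
        by auto
      ultimately show ?thesis
        by (simp only:)
    qed
  qed
qed

lemma open_map_q: "open_map (gtop \<Sigma>) (gtop G) q"
  unfolding open_map_def
proof (intro allI impI)
  fix U assume U: "openin (gtop \<Sigma>) U"
  show "openin (gtop G) (q ` U)"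
  proof (subst openin_subopen, clarify)
    fix \<sigma> assume \<sigma>: "\<sigma> \<in> U"
    obtain B p where B: "open_bisection G B" "q \<sigma> \<in> B"
      and p: "continuous_map (subtopology (gtop G) B) (gtop \<Sigma>) p" "\<And>\<beta>. \<beta> \<in> B \<Longrightarrow> q (p \<beta>) = \<beta>"
        "p (q \<sigma>) = \<sigma>"
      using local_section[OF S.openin_arrows[OF U \<sigma>]] by metis
    have oB: "openin (gtop G) B" using B(1) by (simp add: open_bisection_def)
    let ?T = "{\<beta> \<in> topspace (subtopology (gtop G) B). p \<beta> \<in> U}"
    have "openin (gtop G) ?T"
      using openin_continuous_map_preimage[OF p(1) U] oB openin_trans_full by blast
    moreover have "q \<sigma> \<in> ?T"
      using B(2) p(3) \<sigma> openin_subset[OF oB] by auto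
    moreover have "?T \<subseteq> q ` U"
    proof
      fix \<beta> assume "\<beta> \<in> ?T"
      then show "\<beta> \<in> q ` U"
        using p(2)[of \<beta>] by (auto intro!: image_eqI[of _ q "p \<beta>"])
    qed
    ultimately show "\<exists>T. openin (gtop G) T \<and> q \<sigma> \<in> T \<and> T \<subseteq> q ` U"
      by blast
  qed
qed

text \<open>The image of a compact open bisection of \<open>G\<close> under a local section of \<open>q\<close>. Injectivity of \<open>q\<close> on it makes
  its indicator well defined, and injectivity of the range map makes convolution with the indicator
  a translation.\<close>

lemma compact_open_section:
  assumes "\<sigma> \<in> arrows \<Sigma>"
  obtains Y where "openin (gtop \<Sigma>) Y" "compactin (gtop \<Sigma>) Y" "\<sigma> \<in> Y" "inj_on q Y" "inj_on (rng \<Sigma>) Y"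
proof -
  obtain B p where B: "open_bisection G B" "q \<sigma> \<in> B"
    and p: "continuous_map (subtopology (gtop G) B) (gtop \<Sigma>) p" "\<And>\<beta>. \<beta> \<in> B \<Longrightarrow> q (p \<beta>) = \<beta>"
      "p (q \<sigma>) = \<sigma>" "\<And>B'. \<lbrakk>openin (gtop G) B'; B' \<subseteq> B\<rbrakk> \<Longrightarrow> openin (gtop \<Sigma>) (p ` B')"
    using local_section[OF assms] by metis
  obtain B' where B': "compactin (gtop G) B'" "open_bisection G B'" "q \<sigma> \<in> B'" "B' \<subseteq> B"
    using G.compact_open_bisection_basis[of B "q \<sigma>"] B by (auto simp: open_bisection_def)
  have oY: "openin (gtop \<Sigma>) (p ` B')"
    using p(4) B'(2,4) by (simp add: open_bisection_def)
  show ?thesis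
  proof
    show "openin (gtop \<Sigma>) (p ` B')" by (rule oY)
    show "compactin (gtop \<Sigma>) (p ` B')"
      using image_compactin[OF _ p(1)] B'(1,4) by (simp add: compactin_subtopology)
    show "\<sigma> \<in> p ` B'"
      using B'(3) p(3) by (metis imageI)
    have "p (q x) = x" if "x \<in> p ` B'" for x
      using that p(2) B'(4) by auto
    then show "inj_on q (p ` B')"
      by (metis inj_onI)
    show "inj_on (rng \<Sigma>) (p ` B')"
    proof (rule inj_onI)
      fix x y assume xy: "x \<in> p ` B'" "y \<in> p ` B'" "rng \<Sigma> x = rng \<Sigma> y"
      then obtain a b where ab: "a \<in> B'" "b \<in> B'" "x = p a" "y = p b" by blast
      have "rng G (q x) = rng G (q y)"
        using xy S.openin_arrows[OF oY] rng_eq_iff by blast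
      then have "rng G a = rng G b"
        using ab p(2)[of a] p(2)[of b] subsetD[OF B'(4)] by simp
      then have "a = b"
        using inj_onD[OF open_bisection_inj[OF B'(2)]] ab(1,2) by blast
      then show "x = y"
        using ab by simp
    qed
  qed
qed

end


section \<open>The twisted Steinberg algebra\<close>

context discrete_twist
begin

abbreviation (input)
  "steinberg \<equiv> twisted_steinberg_algebra G \<Sigma> i q"

abbreviation (input)
  "ind \<equiv> twisted_indicator \<Sigma> i q"

abbreviation (input)
  "conv \<equiv> twisted_conv G \<Sigma> q"

definition contravariant :: "('s \<Rightarrow> 'r) \<Rightarrow> bool" where
  "contravariant f \<longleftrightarrow> (\<forall>\<sigma>\<in>arrows \<Sigma>. \<forall>t\<in>ring_units. f (act t \<sigma>) = unit_inv t * f \<sigma>)"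

lemma steinbergD:
  assumes "f \<in> steinberg"
  shows "\<And>\<sigma>. \<sigma> \<notin> arrows \<Sigma> \<Longrightarrow> f \<sigma> = 0" "locally_constant_on (gtop \<Sigma>) f" "contravariant f"
    "compactin (gtop G) (q ` supp \<Sigma> f)"
  using assms by (auto simp: twisted_steinberg_algebra_def contravariant_def)

lemma contravariantD:
  "\<lbrakk>contravariant f; \<sigma> \<in> arrows \<Sigma>; t \<in> ring_units\<rbrakk> \<Longrightarrow> f (act t \<sigma>) = unit_inv t * f \<sigma>"
  by (simp add: contravariant_def)

lemma supp_saturated:
  assumes "contravariant f" "\<sigma> \<in> arrows \<Sigma>"
  shows "q \<sigma> \<in> q ` supp \<Sigma> f \<longleftrightarrow> f \<sigma> \<noteq> 0"
proof
  assume "q \<sigma> \<in> q ` supp \<Sigma> f"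
  then obtain \<tau> where \<tau>: "\<tau> \<in> arrows \<Sigma>" "f \<tau> \<noteq> 0" "q \<tau> = q \<sigma>"
    by (auto simp: supp_def)
  then obtain t where "t \<in> ring_units" "\<sigma> = act t \<tau>"
    using act_transitive assms(2) by metis
  then show "f \<sigma> \<noteq> 0"
    using contravariantD[OF assms(1) \<tau>(1)] \<tau>(2) unit_inv_mult_eq_0_iff by metis
next
  assume "f \<sigma> \<noteq> 0"
  then show "q \<sigma> \<in> q ` supp \<Sigma> f"
    using assms(2) by (simp add: supp_def)
qed

text \<open>By contravariance, the image of the support and the image of the zero set are complementary.
  Both are open since \<open>q\<close> is an open map, so the support in \<open>G\<close> is closed.\<close>

lemma closedin_support:
  assumes "locally_constant_on (gtop \<Sigma>) f" "contravariant f"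
  shows "closedin (gtop G) (q ` supp \<Sigma> f)"
proof -
  let ?Z = "{\<sigma> \<in> topspace (gtop \<Sigma>). f \<sigma> = 0}"
  have "openin (gtop G) (q ` ?Z)"
    using open_map_q openin_locally_constant[OF assms(1), of "\<lambda>r. r = 0"] unfolding open_map_def by blast
  moreover have "topspace (gtop G) - q ` supp \<Sigma> f = q ` ?Z"
  proof (intro equalityI subsetI)
    fix \<alpha> assume \<alpha>: "\<alpha> \<in> topspace (gtop G) - q ` supp \<Sigma> f"
    then obtain \<sigma> where "\<sigma> \<in> arrows \<Sigma>" "\<alpha> = q \<sigma>"
      using q_surj by (auto simp: arrows_def)
    then show "\<alpha> \<in> q ` ?Z"
      using supp_saturated[OF assms(2)] \<alpha> by (auto simp: arrows_def[symmetric])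
  next
    fix \<alpha> assume "\<alpha> \<in> q ` ?Z"
    then show "\<alpha> \<in> topspace (gtop G) - q ` supp \<Sigma> f"
      using supp_saturated[OF assms(2)] by (auto simp: arrows_def[symmetric])
  qed
  moreover have "q ` supp \<Sigma> f \<subseteq> topspace (gtop G)"
    using q_surj by (auto simp: supp_def arrows_def)
  ultimately show ?thesis
    by (simp add: closedin_def)
qed

text \<open>As the support in \<open>G\<close> is closed, it is compact as soon as it lies in a compact set.\<close>

lemma steinbergI:
  assumes "\<And>\<sigma>. \<sigma> \<notin> arrows \<Sigma> \<Longrightarrow> f \<sigma> = 0" "locally_constant_on (gtop \<Sigma>) f" "contravariant f"
    "compactin (gtop G) K" "q ` supp \<Sigma> f \<subseteq> K"
  shows "f \<in> steinberg"
  using assms closed_compactin[OF assms(4,5) closedin_support[OF assms(2,3)]]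
  by (simp add: twisted_steinberg_algebra_def contravariant_def)

lemma zero_in_steinberg: "(\<lambda>\<sigma>. 0) \<in> steinberg"
  by (rule steinbergI[of _ "{}"])
    (auto simp: locally_constant_on_def contravariant_def supp_def intro: openin_topspace)

lemma diff_in_steinberg:
  assumes f: "f \<in> steinberg" and g: "g \<in> steinberg"
  shows "(\<lambda>\<sigma>. f \<sigma> - g \<sigma>) \<in> steinberg"
proof (rule steinbergI)
  show "f \<sigma> - g \<sigma> = 0" if "\<sigma> \<notin> arrows \<Sigma>" for \<sigma>
    using that steinbergD(1)[OF f] steinbergD(1)[OF g] by simp
  show "locally_constant_on (gtop \<Sigma>) (\<lambda>\<sigma>. f \<sigma> - g \<sigma>)"
    unfolding locally_constant_on_def
  proof
    fix \<sigma> assume \<sigma>: "\<sigma> \<in> topspace (gtop \<Sigma>)"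
    obtain U where U: "openin (gtop \<Sigma>) U" "\<sigma> \<in> U" "\<forall>\<tau>\<in>U. f \<tau> = f \<sigma>"
      using steinbergD(2)[OF f] \<sigma> unfolding locally_constant_on_def by blast
    obtain V where V: "openin (gtop \<Sigma>) V" "\<sigma> \<in> V" "\<forall>\<tau>\<in>V. g \<tau> = g \<sigma>"
      using steinbergD(2)[OF g] \<sigma> unfolding locally_constant_on_def by blast
    have "\<forall>\<tau>\<in>U \<inter> V. f \<tau> - g \<tau> = f \<sigma> - g \<sigma>"
      using U(3) V(3) by (metis IntE)
    then show "\<exists>U. openin (gtop \<Sigma>) U \<and> \<sigma> \<in> U \<and> (\<forall>\<tau>\<in>U. f \<tau> - g \<tau> = f \<sigma> - g \<sigma>)"
      using U(1,2) V(1,2) by (intro exI[of _ "U \<inter> V"]) blast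
  qed
  show "contravariant (\<lambda>\<sigma>. f \<sigma> - g \<sigma>)"
    using steinbergD(3)[OF f] steinbergD(3)[OF g] by (simp add: contravariant_def right_diff_distrib)
  show "compactin (gtop G) (q ` supp \<Sigma> f \<union> q ` supp \<Sigma> g)"
    using steinbergD(4)[OF f] steinbergD(4)[OF g] by (rule compactin_Un)
  show "q ` supp \<Sigma> (\<lambda>\<sigma>. f \<sigma> - g \<sigma>) \<subseteq> q ` supp \<Sigma> f \<union> q ` supp \<Sigma> g"
    by (auto simp: supp_def)
qed


section \<open>Indicators of sections of the twist\<close>

text \<open>Injectivity of \<open>q\<close> on \<open>X\<close> determines the point of \<open>X\<close>, and then freeness of the action the scalar.\<close>

lemma indicator_act:
  assumes X: "X \<subseteq> arrows \<Sigma>" "inj_on q X" and "x \<in> X" "t \<in> ring_units"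
  shows "ind X (act t x) = unit_inv t"
proof -
  have "u = t" if u: "u \<in> ring_units" "act t x \<in> act u ` X" for u
  proof -
    obtain y where y: "y \<in> X" "act t x = act u y" using u(2) by blast
    have "q x = q y"
      using arg_cong[OF y(2), of q] X(1) assms(3,4) y(1) u(1) by (simp add: q_act subset_eq)
    then have "y = x"
      using inj_onD[OF X(2)] y(1) assms(3) by metis
    then show "u = t"
      using act_free[of x u t] y(2) X(1) assms(3,4) u(1) by auto
  qed
  then have "(THE u. u \<in> ring_units \<and> act t x \<in> act u ` X) = t"
    using assms(3,4) by (intro the_equality) auto
  then show ?thesis
    using assms(3,4) by (auto simp: twisted_indicator_def)
qed

lemma indicator_nonzeroE:
  assumes "ind X \<sigma> \<noteq> 0"
  obtains t x where "t \<in> ring_units" "x \<in> X" "\<sigma> = act t x"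
  using assms by (auto simp: twisted_indicator_def split: if_splits)

text \<open>The function is constant on each of the open sets \<open>act t ` X\<close>. It vanishes on the complement of their
  union, which is open because it consists of the arrows that \<open>q\<close> maps outside the compact, hence
  closed, set \<open>q ` X\<close>.\<close>

lemma scaled_indicator_in_steinberg:
  assumes X: "openin (gtop \<Sigma>) X" "compactin (gtop \<Sigma>) X" "inj_on q X"
  shows "(\<lambda>\<sigma>. r * ind X \<sigma>) \<in> steinberg"
proof (rule steinbergI)
  have X_arrows: "X \<subseteq> arrows \<Sigma>"
    using S.openin_arrows[OF X(1)] by blast
  note ind = indicator_act[OF X_arrows X(3)]
  have compact: "compactin (gtop G) (q ` X)"
    by (rule image_compactin[OF X(2) q_continuous])
  have outside: "ind X \<sigma> = 0" if "q \<sigma> \<notin> q ` X" for \<sigma>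
    using that indicator_nonzeroE[of X \<sigma>] q_act X_arrows by (metis imageI subsetD)
  have act_X: "\<exists>t\<in>ring_units. \<exists>x\<in>X. \<sigma> = act t x" if "\<sigma> \<in> arrows \<Sigma>" "q \<sigma> \<in> q ` X" for \<sigma>
    using that X_arrows act_transitive[of _ \<sigma>] by (metis imageE subsetD)
  show "r * ind X \<sigma> = 0" if "\<sigma> \<notin> arrows \<Sigma>" for \<sigma>
  proof -
    have "ind X \<sigma> = 0"
      using that indicator_nonzeroE[of X \<sigma>] act_in_arrows X_arrows by (metis subsetD)
    then show ?thesis by simp
  qed
  show "locally_constant_on (gtop \<Sigma>) (\<lambda>\<sigma>. r * ind X \<sigma>)"
    unfolding locally_constant_on_def arrows_def[symmetric]
  proof
    fix \<sigma> assume \<sigma>: "\<sigma> \<in> arrows \<Sigma>"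
    show "\<exists>U. openin (gtop \<Sigma>) U \<and> \<sigma> \<in> U \<and> (\<forall>\<tau>\<in>U. r * ind X \<tau> = r * ind X \<sigma>)"
    proof (cases "q \<sigma> \<in> q ` X")
      case True
      then obtain t x where t: "t \<in> ring_units" "x \<in> X" "\<sigma> = act t x"
        using act_X \<sigma> by blast
      have "\<forall>\<tau>\<in>act t ` X. r * ind X \<tau> = r * ind X \<sigma>"
        using t ind by auto
      then show ?thesis
        using openin_act[OF X(1) t(1)] t by blast
    next
      case False
      let ?U = "{\<sigma> \<in> arrows \<Sigma>. q \<sigma> \<in> topspace (gtop G) - q ` X}"
      have "closedin (gtop G) (q ` X)"
        using compactin_imp_closedin[OF Hausdorff_base compact] .
      then have "openin (gtop \<Sigma>) ?U"
        by (intro openin_q_preimage openin_diff openin_topspace)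
      moreover have "\<sigma> \<in> ?U"
        using False \<sigma> q_in_arrows[OF \<sigma>] by (simp add: arrows_def)
      moreover have "\<forall>\<tau>\<in>?U. r * ind X \<tau> = r * ind X \<sigma>"
        using outside False by simp
      ultimately show ?thesis by blast
    qed
  qed
  show "contravariant (\<lambda>\<sigma>. r * ind X \<sigma>)"
    unfolding contravariant_def
  proof (intro ballI)
    fix \<sigma> t assume \<sigma>: "\<sigma> \<in> arrows \<Sigma>" and t: "t \<in> (ring_units :: 'r set)"
    show "r * ind X (act t \<sigma>) = unit_inv t * (r * ind X \<sigma>)"
    proof (cases "q \<sigma> \<in> q ` X")
      case True
      then obtain u x where u: "u \<in> ring_units" "x \<in> X" "\<sigma> = act u x"
        using act_X \<sigma> by blast
      then have "act t \<sigma> = act (t * u) x"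
        using t X_arrows by (auto intro: act_act)
      then show ?thesis
        using u t ind by (simp add: mult_in_ring_units(1) unit_inv_of_mult ac_simps)
    next
      case False
      then show ?thesis
        using outside q_act[OF \<sigma> t] by simp
    qed
  qed
  show "compactin (gtop G) (q ` X)" by (rule compact)
  show "q ` supp \<Sigma> (\<lambda>\<sigma>. r * ind X \<sigma>) \<subseteq> q ` X"
    using outside by (force simp: supp_def)
qed

lemma indicator_in_steinberg:
  "\<lbrakk>openin (gtop \<Sigma>) X; compactin (gtop \<Sigma>) X; inj_on q X\<rbrakk> \<Longrightarrow> ind X \<in> steinberg"
  using scaled_indicator_in_steinberg[of X 1] by simp


section \<open>Convolution with indicators\<close>

lemma inv_act_mult:
  assumes "\<sigma> \<in> arrows \<Sigma>" "\<tau> \<in> arrows \<Sigma>" "rng \<Sigma> \<tau> = rng \<Sigma> \<sigma>" "t \<in> ring_units"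
  shows "gmult \<Sigma> (ginv \<Sigma> (act t \<tau>)) \<sigma> = act (unit_inv t) (gmult \<Sigma> (ginv \<Sigma> \<tau>) \<sigma>)"
proof -
  let ?z = "gmult \<Sigma> (ginv \<Sigma> \<tau>) \<sigma>"
  have z: "?z \<in> arrows \<Sigma>" "rng \<Sigma> ?z = src \<Sigma> \<tau>"
    using assms by (simp_all add: S.inv_closed)
  have "gmult \<Sigma> (act t \<tau>) (act (unit_inv t) ?z) = act (t * unit_inv t) (gmult \<Sigma> \<tau> ?z)"
    using assms z
    by (simp add: act_mult_left act_mult_right act_act act_in_arrows rng_act unit_inv_in_ring_units)
  also have "\<dots> = \<sigma>"
    using assms by (simp add: mult_unit_inv S.mult_inv_cancel act_one)
  finally show ?thesis
    using S.inv_mult_cancel[of "act t \<tau>" "act (unit_inv t) ?z"] assms z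
    by (simp add: act_in_arrows rng_act src_act unit_inv_in_ring_units)
qed

lemma chosen_lift:
  assumes "\<alpha> \<in> arrows G"
  shows "inv_into (arrows \<Sigma>) q \<alpha> \<in> arrows \<Sigma>" "q (inv_into (arrows \<Sigma>) q \<alpha>) = \<alpha>"
  using assms q_surj by (auto intro: inv_into_into f_inv_into_f)

text \<open>At most one point of \<open>X\<close> has the same range as \<open>\<sigma>\<close>, so at most one summand survives; the scalar by
  which the chosen lift of its image in \<open>G\<close> differs from it cancels by contravariance.\<close>

lemma conv_indicator_left:
  assumes X: "X \<subseteq> arrows \<Sigma>" "inj_on q X" "inj_on (rng \<Sigma>) X"
    and f: "contravariant f" and x: "x \<in> X" "rng \<Sigma> x = rng \<Sigma> \<sigma>" and \<sigma>: "\<sigma> \<in> arrows \<Sigma>"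
  shows "conv (ind X) f \<sigma> = f (gmult \<Sigma> (ginv \<Sigma> x) \<sigma>)"
proof (cases "(1 :: 'r) = 0")
  \<comment> \<open>over the zero ring \<open>indicator_act\<close> does not make \<open>X\<close> part of the support, but all values agree\<close>
  case True
  then have "a = 0" for a :: 'r
    using mult_1[of a] mult_zero_left[of a] by metis
  then show ?thesis by metis
next
  case False
  have x_arrows: "x \<in> arrows \<Sigma>" using x(1) X(1) by blast
  let ?s = "inv_into (arrows \<Sigma>) q (q x)"
  have "{\<alpha>. \<alpha> \<in> q ` supp \<Sigma> (ind X) \<and> rng G \<alpha> = rng G (q \<sigma>)} = {q x}" (is "?I = _")
  proof (intro equalityI subsetI)
    fix \<alpha> assume \<alpha>: "\<alpha> \<in> ?I"
    then obtain \<tau> where \<tau>: "\<alpha> = q \<tau>" "ind X \<tau> \<noteq> 0"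
      by (auto simp: supp_def)
    then obtain t y where y: "t \<in> ring_units" "y \<in> X" "\<tau> = act t y"
      by (metis indicator_nonzeroE)
    then have y_arrows: "y \<in> arrows \<Sigma>" and qy: "\<alpha> = q y"
      using X(1) \<tau>(1) q_act by auto
    then have "rng \<Sigma> y = rng \<Sigma> x"
      using \<alpha> rng_eq_iff[OF y_arrows \<sigma>] x(2) by simp
    then show "\<alpha> \<in> {q x}"
      using inj_onD[OF X(3) _ y(2) x(1)] qy by simp
  next
    fix \<alpha> assume "\<alpha> \<in> {q x}"
    moreover have "x \<in> supp \<Sigma> (ind X)"
      using indicator_act[OF X(1,2) x(1) one_in_ring_units] x_arrows False by (simp add: supp_def act_one)
    ultimately show "\<alpha> \<in> ?I"
      using rng_eq_iff[OF x_arrows \<sigma>] x(2) by auto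
  qed
  then have "conv (ind X) f \<sigma> = ind X ?s * f (gmult \<Sigma> (ginv \<Sigma> ?s) \<sigma>)"
    using \<sigma> by (simp add: twisted_conv_def Let_def)
  also obtain t where t: "t \<in> ring_units" "?s = act t x"
    using act_transitive[of x ?s] x_arrows chosen_lift[of "q x"] by auto
  have "ind X ?s * f (gmult \<Sigma> (ginv \<Sigma> ?s) \<sigma>) = f (gmult \<Sigma> (ginv \<Sigma> x) \<sigma>)"
  proof -
    have "f (gmult \<Sigma> (ginv \<Sigma> ?s) \<sigma>) = t * f (gmult \<Sigma> (ginv \<Sigma> x) \<sigma>)"
      using contravariantD[OF f, of "gmult \<Sigma> (ginv \<Sigma> x) \<sigma>" "unit_inv t"]
        inv_act_mult[OF \<sigma> x_arrows x(2) t(1)] t \<sigma> x_arrows x(2)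
      by (simp add: S.inv_closed unit_inv_in_ring_units unit_inv_unit_inv)
    then show ?thesis
      using indicator_act[OF X(1,2) x(1) t(1)] t
      by (simp add: unit_inv_mult mult.assoc[symmetric])
  qed
  finally show ?thesis .
qed

lemma conv_indicator_left_zero:
  assumes X: "X \<subseteq> arrows \<Sigma>" and "\<And>x. x \<in> X \<Longrightarrow> rng \<Sigma> x \<noteq> rng \<Sigma> \<sigma>"
  shows "conv (ind X) f \<sigma> = 0"
proof (cases "\<sigma> \<in> arrows \<Sigma>")
  case True
  have "{\<alpha>. \<alpha> \<in> q ` supp \<Sigma> (ind X) \<and> rng G \<alpha> = rng G (q \<sigma>)} = {}" (is "?I = _")
  proof (rule ccontr)
    assume "?I \<noteq> {}"
    then obtain \<tau> where \<tau>: "\<tau> \<in> arrows \<Sigma>" "ind X \<tau> \<noteq> 0" "rng G (q \<tau>) = rng G (q \<sigma>)"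
      by (auto simp: supp_def)
    then obtain t y where y: "t \<in> ring_units" "y \<in> X" "\<tau> = act t y"
      by (metis indicator_nonzeroE)
    then have "rng \<Sigma> y = rng \<Sigma> \<tau>"
      using X rng_act[of y t] by auto
    then show False
      using assms(2)[OF y(2)] rng_eq_iff[OF \<tau>(1) True] \<tau>(3) by simp
  qed
  then show ?thesis
    by (simp only: twisted_conv_def Let_def sum.empty if_cancel)
qed (simp add: twisted_conv_def)

text \<open>In a Hausdorff groupoid the composable pairs form a closed set, given by the equation \<open>src a = rng b\<close>
  between continuous maps.\<close>

lemma compactin_products:
  assumes "compactin (gtop G) C" "compactin (gtop G) D"
  shows "compactin (gtop G) ((\<lambda>(a, b). gmult G a b) ` (composable G \<inter> C \<times> D))"
proof (rule image_compactin[OF _ G.continuous_mult])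
  let ?P = "prod_topology (gtop G) (gtop G)"
  have "closedin ?P {p \<in> topspace ?P. (src G \<circ> fst) p = (rng G \<circ> snd) p}"
    by (rule closedin_continuous_maps_eq[OF Hausdorff_base])
      (rule continuous_map_compose[OF continuous_map_fst G.continuous_map_src]
        continuous_map_compose[OF continuous_map_snd G.continuous_map_rng])+
  also have "{p \<in> topspace ?P. (src G \<circ> fst) p = (rng G \<circ> snd) p} = composable G"
    by (auto simp: composable_def arrows_def)
  finally have "closedin ?P (composable G)" .
  moreover have "compactin ?P (C \<times> D)"
    using assms by (simp add: compactin_Times)
  ultimately show "compactin (subtopology ?P (composable G)) (composable G \<inter> C \<times> D)"
    by (auto simp: compactin_subtopology intro: closed_Int_compactin)
qed

text \<open>Near an arrow whose range is attained on \<open>X\<close>, the convolution is \<open>f\<close> composed with the continuous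
  map dividing by the point of \<open>X\<close> with the same range. Elsewhere it vanishes, and this happens on
  an open set since the image of \<open>X\<close> under the range map is compact, hence closed.\<close>

lemma conv_indicator_left_in_steinberg:
  assumes X: "openin (gtop \<Sigma>) X" "compactin (gtop \<Sigma>) X" "inj_on q X" "inj_on (rng \<Sigma>) X"
    and f: "f \<in> steinberg"
  shows "conv (ind X) f \<in> steinberg"
proof (rule steinbergI)
  have X_arrows: "X \<subseteq> arrows \<Sigma>"
    using S.openin_arrows[OF X(1)] by blast
  note left = conv_indicator_left[OF X_arrows X(3,4) steinbergD(3)[OF f]]
  note zero = conv_indicator_left_zero[OF X_arrows]
  show "conv (ind X) f \<sigma> = 0" if "\<sigma> \<notin> arrows \<Sigma>" for \<sigma>
    using that by (simp add: twisted_conv_def)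
  show "contravariant (conv (ind X) f)"
    unfolding contravariant_def
  proof (intro ballI)
    fix \<sigma> t assume \<sigma>: "\<sigma> \<in> arrows \<Sigma>" and t: "t \<in> (ring_units :: 'r set)"
    show "conv (ind X) f (act t \<sigma>) = unit_inv t * conv (ind X) f \<sigma>"
    proof (cases "\<exists>x\<in>X. rng \<Sigma> x = rng \<Sigma> \<sigma>")
      case True
      then obtain x where x: "x \<in> X" "rng \<Sigma> x = rng \<Sigma> \<sigma>" by blast
      then have x_arrows: "x \<in> arrows \<Sigma>" using X_arrows by blast
      have "conv (ind X) f (act t \<sigma>) = f (act t (gmult \<Sigma> (ginv \<Sigma> x) \<sigma>))"
        using left[OF x(1), of "act t \<sigma>"] x \<sigma> t x_arrows
        by (simp add: rng_act act_in_arrows act_mult_right S.inv_closed)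
      then show ?thesis
        using left[OF x \<sigma>] contravariantD[OF steinbergD(3)[OF f] _ t] \<sigma> x x_arrows
        by (simp add: S.inv_closed)
    next
      case False
      then have "conv (ind X) f (act t \<sigma>) = 0" "conv (ind X) f \<sigma> = 0"
        using zero rng_act[OF \<sigma> t] by metis+
      then show ?thesis by simp
    qed
  qed
  show "locally_constant_on (gtop \<Sigma>) (conv (ind X) f)"
    unfolding locally_constant_on_def arrows_def[symmetric]
  proof
    fix \<sigma> assume \<sigma>: "\<sigma> \<in> arrows \<Sigma>"
    show "\<exists>U. openin (gtop \<Sigma>) U \<and> \<sigma> \<in> U \<and>
        (\<forall>\<tau>\<in>U. conv (ind X) f \<tau> = conv (ind X) f \<sigma>)"
    proof (cases "\<sigma> \<in> {\<sigma> \<in> arrows \<Sigma>. rng \<Sigma> \<sigma> \<in> rng \<Sigma> ` X}")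
      case True
      then obtain x where x: "x \<in> X" "rng \<Sigma> x = rng \<Sigma> \<sigma>" by auto
      have x_arrows: "x \<in> arrows \<Sigma>" using x X_arrows by blast
      let ?\<rho> = "gmult \<Sigma> (ginv \<Sigma> x) \<sigma>"
      have \<rho>: "?\<rho> \<in> topspace (gtop \<Sigma>)"
        using x_arrows x \<sigma> S.mult_in_arrows[of "ginv \<Sigma> x" \<sigma>] by (simp add: S.inv_closed arrows_def[symmetric])
      obtain U where U: "openin (gtop \<Sigma>) U" "?\<rho> \<in> U" "\<forall>\<tau>\<in>U. f \<tau> = f ?\<rho>"
        using steinbergD(2)[OF f] \<rho> unfolding locally_constant_on_def by blast
      let ?P = "prod_topology (gtop \<Sigma>) (gtop \<Sigma>)"
      have "openin (subtopology ?P (composable \<Sigma>))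
          {p \<in> topspace (subtopology ?P (composable \<Sigma>)). (\<lambda>(a, b). gmult \<Sigma> a b) p \<in> U}"
        by (rule openin_continuous_map_preimage[OF S.continuous_mult U(1)])
      then obtain T where T: "openin ?P T" and T_eq:
        "{p \<in> topspace (subtopology ?P (composable \<Sigma>)). (\<lambda>(a, b). gmult \<Sigma> a b) p \<in> U} = T \<inter> composable \<Sigma>"
        unfolding openin_subtopology by blast
      have T_mult: "gmult \<Sigma> a b \<in> U" if "(a, b) \<in> T" "(a, b) \<in> composable \<Sigma>" for a b
      proof -
        have "(a, b) \<in> T \<inter> composable \<Sigma>" using that by blast
        then show ?thesis unfolding T_eq[symmetric] by simp
      qed
      have "(ginv \<Sigma> x, \<sigma>) \<in> composable \<Sigma>"
        using x_arrows x \<sigma> by (simp add: S.composable_iff S.inv_closed)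
      moreover have "(ginv \<Sigma> x, \<sigma>) \<in> topspace ?P"
        using x_arrows \<sigma> by (simp add: S.inv_closed arrows_def[symmetric])
      ultimately have "(ginv \<Sigma> x, \<sigma>) \<in> T \<inter> composable \<Sigma>"
        unfolding T_eq[symmetric] using U(2) by simp
      then have "(ginv \<Sigma> x, \<sigma>) \<in> T" by blast
      then obtain M N where MN: "openin (gtop \<Sigma>) M" "openin (gtop \<Sigma>) N" "ginv \<Sigma> x \<in> M" "\<sigma> \<in> N"
        "M \<times> N \<subseteq> T"
        using T unfolding openin_prod_topology_alt by metis
      \<comment> \<open>the range map is open, so the arrows with the same range as a point of \<open>X\<close> near \<open>x\<close> form an open set\<close>
      let ?X = "X \<inter> {x \<in> arrows \<Sigma>. ginv \<Sigma> x \<in> M}"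
      have oX: "openin (gtop \<Sigma>) ?X"
        using X(1) S.openin_inv_preimage[OF MN(1)] by blast
      let ?U = "N \<inter> {\<sigma> \<in> arrows \<Sigma>. rng \<Sigma> \<sigma> \<in> rng \<Sigma> ` ?X}"
      have "openin (gtop \<Sigma>) ?U"
        using S.openin_rng_preimage[OF S.openin_rng_image[OF oX]] MN(2) by blast
      moreover have "\<sigma> \<in> ?U"
        using MN(3,4) \<sigma> x x_arrows by (auto intro!: rev_image_eqI[of x])
      moreover have "conv (ind X) f \<tau> = conv (ind X) f \<sigma>" if \<tau>: "\<tau> \<in> ?U" for \<tau>
      proof -
        obtain y where y: "y \<in> X" "ginv \<Sigma> y \<in> M" "rng \<Sigma> y = rng \<Sigma> \<tau>" "\<tau> \<in> arrows \<Sigma>" "\<tau> \<in> N"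
          using \<tau> by auto
        then have "(ginv \<Sigma> y, \<tau>) \<in> T" "(ginv \<Sigma> y, \<tau>) \<in> composable \<Sigma>"
          using MN(5) X_arrows by (auto simp: S.composable_iff S.inv_closed subset_eq)
        then have "gmult \<Sigma> (ginv \<Sigma> y) \<tau> \<in> U"
          by (rule T_mult)
        then have "f (gmult \<Sigma> (ginv \<Sigma> y) \<tau>) = f ?\<rho>"
          using U(3) by blast
        then show ?thesis
          using left[OF y(1,3,4)] left[OF x \<sigma>] by simp
      qed
      ultimately show ?thesis by blast
    next
      case False
      let ?U = "{\<tau> \<in> arrows \<Sigma>. rng \<Sigma> \<tau> \<in> topspace (gtop \<Sigma>) - rng \<Sigma> ` X}"
      have "closedin (gtop \<Sigma>) (rng \<Sigma> ` X)"
        by (rule compactin_imp_closedin[OF Hausdorff_twist image_compactin[OF X(2) S.continuous_map_rng]])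
      then have "openin (gtop \<Sigma>) ?U"
        by (intro S.openin_rng_preimage openin_diff openin_topspace)
      moreover have "\<sigma> \<in> ?U"
        using False \<sigma> S.rng_in_arrows[OF \<sigma>] by (simp add: arrows_def)
      moreover have "\<forall>\<tau>\<in>?U. conv (ind X) f \<tau> = 0"
      proof (intro ballI zero)
        fix \<tau> x assume "\<tau> \<in> ?U" "x \<in> X"
        then show "rng \<Sigma> x \<noteq> rng \<Sigma> \<tau>" by (metis (no_types, lifting) DiffE imageI mem_Collect_eq)
      qed
      ultimately show ?thesis by (metis (no_types, lifting))
    qed
  qed
  let ?K = "(\<lambda>(a, b). gmult G a b) ` (composable G \<inter> q ` X \<times> q ` supp \<Sigma> f)"
  show "compactin (gtop G) ?K"
    by (intro compactin_products image_compactin[OF X(2) q_continuous] steinbergD(4)[OF f])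
  show "q ` supp \<Sigma> (conv (ind X) f) \<subseteq> ?K"
  proof clarify
    fix \<sigma> assume "\<sigma> \<in> supp \<Sigma> (conv (ind X) f)"
    then have \<sigma>: "\<sigma> \<in> arrows \<Sigma>" "conv (ind X) f \<sigma> \<noteq> 0"
      by (auto simp: supp_def)
    then obtain x where x: "x \<in> X" "rng \<Sigma> x = rng \<Sigma> \<sigma>"
      using zero by blast
    have x_arrows: "x \<in> arrows \<Sigma>" using x X_arrows by blast
    let ?\<rho> = "gmult \<Sigma> (ginv \<Sigma> x) \<sigma>"
    have \<rho>: "?\<rho> \<in> arrows \<Sigma>" "rng \<Sigma> ?\<rho> = src \<Sigma> x"
      using x_arrows x \<sigma> by (simp_all add: S.inv_closed)
    have "?\<rho> \<in> supp \<Sigma> f"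
      using \<rho>(1) left[OF x \<sigma>(1)] \<sigma>(2) by (simp add: supp_def)
    moreover have "q \<sigma> = gmult G (q x) (q ?\<rho>)"
      using q_mult[OF x_arrows \<rho>(1)] \<rho>(2) S.mult_inv_cancel[OF x_arrows \<sigma>(1) x(2)] by simp
    moreover have "(q x, q ?\<rho>) \<in> composable G"
      using x_arrows \<rho> q_src[OF x_arrows] q_rng[OF \<rho>(1)] by (simp add: G.composable_iff)
    ultimately show "q \<sigma> \<in> ?K"
      using x(1) by (intro image_eqI[of _ _ "(q x, q ?\<rho>)"]) auto
  qed
qed

lemma conv_indicator_units_left:
  assumes W: "W \<subseteq> unit_space \<Sigma>" and f: "contravariant f" and \<sigma>: "\<sigma> \<in> arrows \<Sigma>"
  shows "conv (ind W) f \<sigma> = (if rng \<Sigma> \<sigma> \<in> W then f \<sigma> else 0)"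
proof -
  have W': "W \<subseteq> arrows \<Sigma>" "inj_on q W" "inj_on (rng \<Sigma>) W"
    using W S.unit_in_arrows inj_on_subset[OF inj_on_q_unit_space W] S.unit_rng
    by (auto simp: inj_on_def subset_eq)
  show ?thesis
  proof (cases "rng \<Sigma> \<sigma> \<in> W")
    case True
    then show ?thesis
      using conv_indicator_left[OF W' f True _ \<sigma>] \<sigma> S.unit_inv[of "rng \<Sigma> \<sigma>"] by simp
  next
    case False
    then have "rng \<Sigma> x \<noteq> rng \<Sigma> \<sigma>" if "x \<in> W" for x
      using that W S.unit_rng[of x] by auto
    then show ?thesis
      using False conv_indicator_left_zero[OF W'(1)] by simp
  qed
qed

text \<open>The sum is finite because the compact support of \<open>f\<close> in \<open>G\<close> meets the fibre of the range map in a
  finite set; only the summand at \<open>q \<sigma>\<close> can be nonzero.\<close>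

lemma conv_indicator_units_right:
  assumes W: "W \<subseteq> unit_space \<Sigma>" and f: "f \<in> steinberg" and \<sigma>: "\<sigma> \<in> arrows \<Sigma>"
  shows "conv f (ind W) \<sigma> = (if src \<Sigma> \<sigma> \<in> W then f \<sigma> else 0)"
proof -
  have W': "W \<subseteq> arrows \<Sigma>" "inj_on q W"
    using W S.unit_in_arrows inj_on_subset[OF inj_on_q_unit_space W] by auto
  let ?S = "inv_into (arrows \<Sigma>) q"
  let ?I = "{\<alpha>. \<alpha> \<in> q ` supp \<Sigma> f \<and> rng G \<alpha> = rng G (q \<sigma>)}"
  let ?F = "\<lambda>\<alpha>. f (?S \<alpha>) * ind W (gmult \<Sigma> (ginv \<Sigma> (?S \<alpha>)) \<sigma>)"
  have conv: "conv f (ind W) \<sigma> = sum ?F ?I"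
    using \<sigma> by (simp add: twisted_conv_def Let_def)
  have fin: "finite ?I"
    using G.finite_compact_fibre[OF steinbergD(4)[OF f], of "rng G (q \<sigma>)"] by simp
  have other: "?F \<alpha> = 0" if \<alpha>: "\<alpha> \<in> ?I - {q \<sigma>}" for \<alpha>
  proof (rule ccontr)
    assume nz: "?F \<alpha> \<noteq> 0"
    let ?z = "gmult \<Sigma> (ginv \<Sigma> (?S \<alpha>)) \<sigma>"
    have "\<alpha> \<in> arrows G" using \<alpha> by (auto simp: supp_def)
    then have s: "?S \<alpha> \<in> arrows \<Sigma>" "q (?S \<alpha>) = \<alpha>" by (rule chosen_lift)+
    have rs: "rng \<Sigma> (?S \<alpha>) = rng \<Sigma> \<sigma>"
      using \<alpha> s rng_eq_iff[OF s(1) \<sigma>] by simp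
    have "ind W ?z \<noteq> 0" using nz by auto
    then obtain t w where t: "t \<in> ring_units" "w \<in> W" "?z = act t w"
      by (rule indicator_nonzeroE)
    have w: "w \<in> arrows \<Sigma>" using t(2) W'(1) by blast
    have "rng \<Sigma> ?z = src \<Sigma> (?S \<alpha>)"
      using s rs \<sigma> by (simp add: S.inv_closed)
    then have ws: "w = src \<Sigma> (?S \<alpha>)"
      using t w W S.unit_rng[of w] rng_act[OF w t(1)] by auto
    have "\<sigma> = gmult \<Sigma> (?S \<alpha>) (act t w)"
      using S.mult_inv_cancel[OF s(1) \<sigma> rs] t(3) by simp
    also have "\<dots> = act t (?S \<alpha>)"
      using act_mult_right[OF s(1) w _ t(1)] ws s(1) by simp
    finally have "q \<sigma> = \<alpha>"
      using q_act[OF s(1) t(1)] s(2) by simp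
    then show False using \<alpha> by simp
  qed
  have self: "?F (q \<sigma>) = (if src \<Sigma> \<sigma> \<in> W then f \<sigma> else 0)"
  proof -
    obtain u where u: "u \<in> ring_units" "?S (q \<sigma>) = act u \<sigma>"
      using act_transitive[of \<sigma> "?S (q \<sigma>)"] \<sigma> chosen_lift[of "q \<sigma>"] by auto
    have z: "gmult \<Sigma> (ginv \<Sigma> (?S (q \<sigma>))) \<sigma> = act (unit_inv u) (src \<Sigma> \<sigma>)"
      using inv_act_mult[OF \<sigma> \<sigma> refl u(1)] u(2) by (simp add: src_def)
    have fs: "f (?S (q \<sigma>)) = unit_inv u * f \<sigma>"
      using contravariantD[OF steinbergD(3)[OF f] \<sigma> u(1)] u(2) by simp
    show ?thesis
    proof (cases "src \<Sigma> \<sigma> \<in> W")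
      case True
      have "ind W (act (unit_inv u) (src \<Sigma> \<sigma>)) = u"
        using indicator_act[OF W' True unit_inv_in_ring_units[OF u(1)]] u(1)
        by (simp add: unit_inv_unit_inv)
      then have "?F (q \<sigma>) = (unit_inv u * u) * f \<sigma>"
        unfolding z fs by (simp only: ac_simps)
      then show ?thesis
        using True u(1) by (simp add: unit_inv_mult)
    next
      case False
      have "ind W (act (unit_inv u) (src \<Sigma> \<sigma>)) = 0"
      proof (rule ccontr)
        assume "\<not> ?thesis"
        then obtain t w where t: "t \<in> ring_units" "w \<in> W" "act (unit_inv u) (src \<Sigma> \<sigma>) = act t w"
          by (rule indicator_nonzeroE)
        have "src \<Sigma> \<sigma> = w"
          using arg_cong[OF t(3), of "rng \<Sigma>"] subsetD[OF W t(2)] subsetD[OF W'(1) t(2)] \<sigma> u(1) t(1)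
          by (simp add: rng_act unit_inv_in_ring_units S.unit_rng)
        then show False using False t(2) by simp
      qed
      then show ?thesis
        using False unfolding z by simp
    qed
  qed
  show ?thesis
  proof (cases "q \<sigma> \<in> ?I")
    case True
    have "sum ?F ?I = ?F (q \<sigma>) + sum ?F (?I - {q \<sigma>})"
      by (rule sum.remove[OF fin True])
    also have "sum ?F (?I - {q \<sigma>}) = 0"
      by (rule sum.neutral) (use other in blast)
    finally show ?thesis
      using conv self by simp
  next
    case False
    then have "sum ?F ?I = 0"
      by (intro sum.neutral ballI other) blast
    moreover have "f \<sigma> = 0"
      using False supp_saturated[OF steinbergD(3)[OF f] \<sigma>] by simp
    ultimately show ?thesis
      using conv by simp
  qed
qed

end


section \<open>Homomorphisms out of the algebra\<close>

context discrete_twist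
begin

lemma ring_hom_add:
  "\<lbrakk>twisted_ring_hom G \<Sigma> i q \<pi>; f \<in> steinberg; g \<in> steinberg\<rbrakk> \<Longrightarrow> \<pi> (\<lambda>\<sigma>. f \<sigma> + g \<sigma>) = \<pi> f + \<pi> g"
  unfolding twisted_ring_hom_def by blast

lemma ring_hom_zero:
  assumes "twisted_ring_hom G \<Sigma> i q \<pi>"
  shows "\<pi> (\<lambda>\<sigma>. 0) = 0"
  using ring_hom_add[OF assms zero_in_steinberg zero_in_steinberg] by simp

lemma ring_hom_conv:
  "\<lbrakk>twisted_ring_hom G \<Sigma> i q \<pi>; f \<in> steinberg; g \<in> steinberg\<rbrakk> \<Longrightarrow> \<pi> (conv f g) = \<pi> f * \<pi> g"
  unfolding twisted_ring_hom_def by blast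

text \<open>The heart of the argument: compressing \<open>h\<close> to a set of units on which it is constant, and which is
  joined to itself by no non-unit in the support of \<open>h\<close>, leaves a multiple of an indicator.\<close>

lemma compress_to_indicator:
  assumes h: "h \<in> steinberg" and W: "openin (gtop \<Sigma>) W" "compactin (gtop \<Sigma>) W" "W \<subseteq> unit_space \<Sigma>"
    and const: "\<And>w. w \<in> W \<Longrightarrow> h w = c"
    and avoid: "\<And>\<sigma>. \<lbrakk>\<sigma> \<in> arrows \<Sigma>; h \<sigma> \<noteq> 0; rng \<Sigma> \<sigma> \<in> W; src \<Sigma> \<sigma> \<in> W\<rbrakk> \<Longrightarrow> q \<sigma> \<in> unit_space G"
  shows "conv (conv (ind W) h) (ind W) = (\<lambda>\<sigma>. c * ind W \<sigma>)"
proof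
  fix \<sigma>
  have W': "W \<subseteq> arrows \<Sigma>" "inj_on q W" "inj_on (rng \<Sigma>) W"
    using W(3) S.unit_in_arrows inj_on_subset[OF inj_on_q_unit_space W(3)] S.unit_rng
    by (auto simp: inj_on_def subset_eq)
  have k: "conv (ind W) h \<in> steinberg"
    by (rule conv_indicator_left_in_steinberg[OF W(1,2) W'(2,3) h])
  show "conv (conv (ind W) h) (ind W) \<sigma> = c * ind W \<sigma>"
  proof (cases "\<sigma> \<in> arrows \<Sigma>")
    case False
    have "ind W \<sigma> = 0"
      using False indicator_nonzeroE[of W \<sigma>] act_in_arrows W'(1) by (metis subsetD)
    then show ?thesis
      using False by (simp add: twisted_conv_def)
  next
    case \<sigma>: True
    have eq: "conv (conv (ind W) h) (ind W) \<sigma> = (if rng \<Sigma> \<sigma> \<in> W \<and> src \<Sigma> \<sigma> \<in> W then h \<sigma> else 0)"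
      using conv_indicator_units_right[OF W(3) k \<sigma>]
        conv_indicator_units_left[OF W(3) steinbergD(3)[OF h] \<sigma>] by simp
    show ?thesis
    proof (cases "\<exists>t\<in>ring_units. \<exists>w\<in>W. \<sigma> = act t w")
      case True
      then obtain t w where t: "t \<in> ring_units" "w \<in> W" "\<sigma> = act t w" by blast
      then have "w \<in> unit_space \<Sigma>" "w \<in> arrows \<Sigma>" using W(3) W'(1) by auto
      then have "rng \<Sigma> \<sigma> = w" "src \<Sigma> \<sigma> = w" "h \<sigma> = unit_inv t * c"
        using t contravariantD[OF steinbergD(3)[OF h]]
        by (simp_all add: rng_act src_act S.unit_rng S.unit_src const)
      then show ?thesis
        using eq indicator_act[OF W'(1,2) t(2,1)] t by (simp add: mult.commute)
    next
      case False
      then have "ind W \<sigma> = 0"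
        by (metis indicator_nonzeroE)
      moreover have "h \<sigma> = 0" if rs: "rng \<Sigma> \<sigma> \<in> W" "src \<Sigma> \<sigma> \<in> W"
      proof (rule ccontr)
        assume "h \<sigma> \<noteq> 0"
        then have "q \<sigma> \<in> unit_space G"
          using avoid \<sigma> rs by blast
        then have "q (rng \<Sigma> \<sigma>) = q \<sigma>"
          using \<sigma> by (simp add: q_rng G.unit_rng)
        then show False
          using act_transitive[of "rng \<Sigma> \<sigma>" \<sigma>] \<sigma> rs(1) False S.rng_in_arrows by metis
      qed
      ultimately show ?thesis
        using eq by simp
    qed
  qed
qed

text \<open>Compactness: the set is the image of \<open>B\<close> under the continuous map that identifies the units of \<open>G\<close>
  with those of the twist.\<close>

lemma compact_open_units:
  assumes "openin (gtop G) B" "compactin (gtop G) B" "B \<subseteq> unit_space G"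
  defines "W \<equiv> {\<sigma> \<in> unit_space \<Sigma>. q \<sigma> \<in> B}"
  shows "openin (gtop \<Sigma>) W" "compactin (gtop \<Sigma>) W"
proof -
  have "W = unit_space \<Sigma> \<inter> {\<sigma> \<in> arrows \<Sigma>. q \<sigma> \<in> B}"
    using S.unit_in_arrows by (auto simp: W_def)
  then show "openin (gtop \<Sigma>) W"
    using S.openin_unit_space openin_q_preimage[OF assms(1)] by (simp add: openin_Int)
  have "W = (\<lambda>x. i (x, 1)) ` B"
    using assms(3) i_q_unit(1) i_one_unit q_i by (force simp: W_def image_iff)
  moreover have "continuous_map (unit_top G) (gtop \<Sigma>) (i \<circ> (\<lambda>x. (x, 1)))"
    by (rule continuous_map_compose[OF _ i_continuous])
      (simp add: trivial_bundle_def continuous_map_pairedI)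
  moreover have "compactin (unit_top G) B"
    using assms(2,3) by (simp add: unit_top_def compactin_subtopology)
  ultimately show "compactin (gtop \<Sigma>) W"
    using image_compactin by (fastforce simp: o_def)
qed

text \<open>A translate of \<open>f\<close> in the kernel is nonzero at some unit, and effectiveness provides a set of units near
  it to which the translate can be compressed.\<close>

theorem kernel_contains_scaled_indicator:
  assumes eff: "effective G" and hom: "twisted_ring_hom G \<Sigma> i q \<pi>"
    and f: "f \<in> steinberg" "f \<noteq> (\<lambda>\<sigma>. 0)" "\<pi> f = 0"
  obtains W r where "openin (gtop \<Sigma>) W" "compactin (gtop \<Sigma>) W" "W \<subseteq> unit_space \<Sigma>" "W \<noteq> {}" "r \<noteq> 0"
    "\<pi> (\<lambda>\<sigma>. r * ind W \<sigma>) = 0"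
proof -
  obtain \<sigma> where "f \<sigma> \<noteq> 0" using f(2) by blast
  then have \<sigma>: "\<sigma> \<in> arrows \<Sigma>" using steinbergD(1)[OF f(1)] by blast
  define c where "c = f \<sigma>"
  have c: "c \<noteq> 0" using \<open>f \<sigma> \<noteq> 0\<close> by (simp add: c_def)
  obtain Y where Y: "openin (gtop \<Sigma>) Y" "compactin (gtop \<Sigma>) Y" "ginv \<Sigma> \<sigma> \<in> Y" "inj_on q Y"
    "inj_on (rng \<Sigma>) Y"
    using compact_open_section[OF S.inv_closed[OF \<sigma>]] by metis
  \<comment> \<open>translation along \<open>Y\<close> carries the nonzero value of \<open>f\<close> at \<open>\<sigma>\<close> to the unit \<open>src \<Sigma> \<sigma>\<close>\<close>
  define h where "h = conv (ind Y) f"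
  have h: "h \<in> steinberg"
    unfolding h_def by (rule conv_indicator_left_in_steinberg[OF Y(1,2,4,5) f(1)])
  have \<pi>h: "\<pi> h = 0"
    using ring_hom_conv[OF hom indicator_in_steinberg[OF Y(1,2,4)] f(1)] f(3) by (simp add: h_def)
  have h_src: "h (src \<Sigma> \<sigma>) = c"
  proof -
    have "Y \<subseteq> arrows \<Sigma>" using S.openin_arrows[OF Y(1)] by blast
    then have "h (src \<Sigma> \<sigma>) = f (gmult \<Sigma> (ginv \<Sigma> (ginv \<Sigma> \<sigma>)) (src \<Sigma> \<sigma>))"
      unfolding h_def
      by (rule conv_indicator_left[OF _ Y(4,5) steinbergD(3)[OF f(1)] Y(3)]) (use \<sigma> in simp_all)
    then show ?thesis
      using \<sigma> by (simp add: S.inv_inv c_def)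
  qed
  let ?U = "q ` (unit_space \<Sigma> \<inter> {\<tau> \<in> topspace (gtop \<Sigma>). h \<tau> = c})"
  have U: "openin (gtop G) ?U"
    using open_map_q S.openin_unit_space openin_locally_constant[OF steinbergD(2)[OF h], of "\<lambda>r. r = c"]
    unfolding open_map_def by blast
  have U_units: "?U \<subseteq> unit_space G"
    using i_q_unit(2) by blast
  have U_nonempty: "?U \<noteq> {}"
    using h_src S.src_unit[OF \<sigma>] S.src_in_arrows[OF \<sigma>] unfolding arrows_def by blast
  \<comment> \<open>the non-units in the support of \<open>h\<close>, which \<open>V\<close> below has to avoid\<close>
  let ?K = "q ` supp \<Sigma> h \<inter> (topspace (gtop G) - unit_space G)"
  have "compactin (gtop G) ?K"
    using steinbergD(4)[OF h] G.openin_unit_space by (intro compact_Int_closedin) auto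
  then obtain V where V: "openin (gtop G) V" "V \<noteq> {}" "V \<subseteq> ?U"
    "\<And>b. \<lbrakk>b \<in> ?K; rng G b \<in> V\<rbrakk> \<Longrightarrow> src G b \<notin> V"
    using G.effective_avoid_compact[OF Hausdorff_base eff _ _ U U_nonempty U_units, of ?K] by blast
  then obtain x where "x \<in> V" by blast
  then obtain B where B: "compactin (gtop G) B" "open_bisection G B" "x \<in> B" "B \<subseteq> V"
    using G.compact_open_bisection_basis[OF V(1)] by blast
  let ?W = "{\<tau> \<in> unit_space \<Sigma>. q \<tau> \<in> B}"
  have B_units: "B \<subseteq> unit_space G"
    using B(4) V(3) U_units by blast
  have W: "openin (gtop \<Sigma>) ?W" "compactin (gtop \<Sigma>) ?W" "?W \<subseteq> unit_space \<Sigma>"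
    using compact_open_units[OF _ B(1) B_units] B(2) by (auto simp: open_bisection_def)
  have W': "inj_on q ?W" "inj_on (rng \<Sigma>) ?W"
    using inj_on_subset[OF inj_on_q_unit_space W(3)] S.unit_rng by (auto simp: inj_on_def)
  have W_nonempty: "?W \<noteq> {}"
  proof -
    have x: "x \<in> unit_space G" using B(3) B_units by blast
    have "i (x, 1) \<in> ?W" using i_one_unit[OF x] q_i[OF x one_in_ring_units] B(3) by simp
    then show ?thesis by blast
  qed
  have "conv (conv (ind ?W) h) (ind ?W) = (\<lambda>\<sigma>. c * ind ?W \<sigma>)"
  proof (rule compress_to_indicator[OF h W])
    fix w assume w: "w \<in> ?W"
    then have "q w \<in> ?U" using B(4) V(3) by blast
    then obtain \<tau> where \<tau>: "\<tau> \<in> unit_space \<Sigma>" "h \<tau> = c" "q w = q \<tau>" by blast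
    then have "w = \<tau>"
      using inj_onD[OF inj_on_q_unit_space] w by blast
    then show "h w = c" using \<tau>(2) by simp
  next
    fix \<tau> assume \<tau>: "\<tau> \<in> arrows \<Sigma>" "h \<tau> \<noteq> 0" "rng \<Sigma> \<tau> \<in> ?W" "src \<Sigma> \<tau> \<in> ?W"
    then have "rng G (q \<tau>) \<in> V" "src G (q \<tau>) \<in> V"
      using B(4) by (auto simp: q_rng q_src)
    then have "q \<tau> \<notin> ?K" using V(4) by blast
    then show "q \<tau> \<in> unit_space G"
      using \<tau>(1,2) q_in_arrows[OF \<tau>(1)] by (auto simp: supp_def arrows_def)
  qed
  moreover have "\<pi> (conv (conv (ind ?W) h) (ind ?W)) = 0"
    using ring_hom_conv[OF hom] indicator_in_steinberg[OF W(1,2) W'(1)] h \<pi>h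
      conv_indicator_left_in_steinberg[OF W(1,2) W' h] by simp
  ultimately show ?thesis
    using that[OF W W_nonempty c] by simp
qed

end

theorem corollary3p10:
  fixes G :: "'g tgroupoid" and \<Sigma> :: "'s tgroupoid"
    and i :: "'g \<times> 'r::{comm_ring, comm_monoid_mult} \<Rightarrow> 's" and q :: "'s \<Rightarrow> 'g"
    and \<pi> :: "('s \<Rightarrow> 'r) \<Rightarrow> 'q::ring"
  assumes "discrete_twist G \<Sigma> i q"
    and "effective G"
    and "twisted_ring_hom G \<Sigma> i q \<pi>"
  shows "inj_on \<pi> (twisted_steinberg_algebra G \<Sigma> i q) \<longleftrightarrow>
    (\<forall>W r. openin (unit_top \<Sigma>) W \<and> compactin (unit_top \<Sigma>) W \<and> W \<noteq> {} \<and> r \<noteq> 0 \<longrightarrow>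
       \<pi> (\<lambda>\<sigma>. r * twisted_indicator \<Sigma> i q W \<sigma>) \<noteq> 0)"
proof -
  interpret discrete_twist G \<Sigma> i q by fact
  have unit_top: "openin (unit_top \<Sigma>) W \<and> compactin (unit_top \<Sigma>) W \<longleftrightarrow>
      openin (gtop \<Sigma>) W \<and> compactin (gtop \<Sigma>) W \<and> W \<subseteq> unit_space \<Sigma>" for W
    using S.openin_unit_top_iff[of W] by (auto simp: unit_top_def compactin_subtopology)
  show ?thesis
  proof (intro iffI allI impI)
    fix W and r :: 'r
    assume inj: "inj_on \<pi> (twisted_steinberg_algebra G \<Sigma> i q)"
      and W: "openin (unit_top \<Sigma>) W \<and> compactin (unit_top \<Sigma>) W \<and> W \<noteq> {} \<and> r \<noteq> 0"
    then have W': "openin (gtop \<Sigma>) W" "compactin (gtop \<Sigma>) W" "W \<subseteq> unit_space \<Sigma>"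
      using unit_top by blast+
    have inj_W: "inj_on q W"
      by (rule inj_on_subset[OF inj_on_q_unit_space W'(3)])
    obtain w where w: "w \<in> W" using W by blast
    have W_arrows: "W \<subseteq> arrows \<Sigma>" using W'(3) S.unit_in_arrows by blast
    have "twisted_indicator \<Sigma> i q W w = (1 :: 'r)"
      using indicator_act[OF W_arrows inj_W w one_in_ring_units] w W_arrows act_one[of w] by auto
    then have "(\<lambda>\<sigma>. r * twisted_indicator \<Sigma> i q W \<sigma>) \<noteq> (\<lambda>\<sigma>. 0)"
      using W by (metis mult.right_neutral)
    then show "\<pi> (\<lambda>\<sigma>. r * twisted_indicator \<Sigma> i q W \<sigma>) \<noteq> 0"
      using inj_onD[OF inj _ scaled_indicator_in_steinberg[OF W'(1,2) inj_W] zero_in_steinberg]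
        ring_hom_zero[OF assms(3)] by auto
  next
    assume *: "\<forall>W r. openin (unit_top \<Sigma>) W \<and> compactin (unit_top \<Sigma>) W \<and> W \<noteq> {} \<and> r \<noteq> 0 \<longrightarrow>
       \<pi> (\<lambda>\<sigma>. r * twisted_indicator \<Sigma> i q W \<sigma>) \<noteq> 0"
    show "inj_on \<pi> (twisted_steinberg_algebra G \<Sigma> i q)"
    proof (rule inj_onI, rule ccontr)
      fix f g assume f: "f \<in> twisted_steinberg_algebra G \<Sigma> i q" and g: "g \<in> twisted_steinberg_algebra G \<Sigma> i q"
        and eq: "\<pi> f = \<pi> g" and ne: "f \<noteq> g"
      let ?d = "\<lambda>\<sigma>. f \<sigma> - g \<sigma>"
      have d: "?d \<in> twisted_steinberg_algebra G \<Sigma> i q"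
        by (rule diff_in_steinberg[OF f g])
      have "\<pi> ?d = 0"
        using ring_hom_add[OF assms(3) d g] eq by simp
      moreover have "?d \<noteq> (\<lambda>\<sigma>. 0)"
        using ne by (auto simp: fun_eq_iff)
      ultimately obtain W r where "openin (gtop \<Sigma>) W" "compactin (gtop \<Sigma>) W" "W \<subseteq> unit_space \<Sigma>"
        "W \<noteq> {}" "r \<noteq> 0" "\<pi> (\<lambda>\<sigma>. r * twisted_indicator \<Sigma> i q W \<sigma>) = 0"
        using kernel_contains_scaled_indicator[OF assms(2,3) d] by metis
      then show False
        using * unit_top by blast
    qed
  qed
qed

end
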